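(* Let $A$ be a fixed Hermitian $N\times N$ matrix and $V=\operatorname{diag}(V_1,\dots,V_N)$ with $V_1,\dots,V_N$ independent real random variables, each having the same bounded density $\rho\in L^1\cap L^\infty$. Let $H=A+V$ and $S(z)=N^{-1}\operatorname{Tr}(H-z)^{-1}$. There are constants $c,C\in(0,\infty)$ independent of $N$ such that for all $\mu>0$ and $z=E+i\eta$ with $\eta>0$, \[\mathbb{P}\big(\operatorname{Im}S(z)>c+\mu\big)\le\exp(-\mu N\eta)\] and \[\mathbb{P}\big(|S(z)|>c[1+\log(1+\eta^{-1})]\big)\le\frac{C}{\eta^2}\exp(-N\eta).\] *)

theory Defs
  imports "HOL-Probability.Probability" "Jordan_Normal_Form.Gauss_Jordan_Elimination"
begin

definition hermitian_mat :: "nat \<Rightarrow> complex mat \<Rightarrow> bool" where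
  "hermitian_mat n A \<longleftrightarrow> A \<in> carrier_mat n n \<and>
     (\<forall>i<n. \<forall>j<n. A $$ (i, j) = cnj (A $$ (j, i)))"

definition mat_trace :: "'a::comm_monoid_add mat \<Rightarrow> 'a" where
  "mat_trace M = (\<Sum>i<dim_row M. M $$ (i, i))"

definition mat_inv :: "'a::field mat \<Rightarrow> 'a mat" where
  "mat_inv M = the (mat_inverse M)"

definition stieltjes :: "nat \<Rightarrow> complex mat \<Rightarrow> (nat \<Rightarrow> real) \<Rightarrow> complex \<Rightarrow> complex" where
  "stieltjes N A v z =
     mat_trace (mat_inv (A + mat_diag N (\<lambda>i. complex_of_real (v i)) - z \<cdot>\<^sub>m 1\<^sub>m N)) / of_nat N"

definition potential_law :: "nat \<Rightarrow> (real \<Rightarrow> real) \<Rightarrow> (nat \<Rightarrow> real) measure" where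
  "potential_law N \<rho> = PiM {..<N} (\<lambda>_. density lborel (\<lambda>x. ennreal (\<rho> x)))"

end

theory Submission
  imports Defs "Jordan_Normal_Form.Schur_Decomposition"
begin

text \<open>
  Put K = i(H - z), so that Re K = \<eta> and the real part of G = K^{-1} is Im (H - z)^{-1}. The
  eigenvalues of \<eta> Re G lie in [0, 1], so bounding exp by its chord gives
  exp (N \<eta> Im S(z)) \<le> det (1 + t Re G) with t = (e - 1) \<eta>. The expectation of this determinant is
  at most (1 + t \<pi> B)^N, where B bounds \<rho>; Markov's inequality then gives the first estimate with
  c = (e - 1) \<pi> B.

  The determinant bound is proved by induction on N for all K with positive definite real part
  (an estimate of Minami type). With D(K) = det (1 + t Re K^{-1}), K'' the Schur complement of the last
  diagonal entry of K and K' the leading principal minor,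
    D(K) \<le> D(K'') + t Re (G_{NN}) D(K').
  Here K'' does not involve v_1, ..., v_{N-1} except on its diagonal, K' does not involve v_N, and as a
  function of v_N the factor Re (G_{NN}) is a Poisson kernel, whose integral against \<rho> is at most \<pi> B.

  For the second estimate, |S(E + i\<eta>) - S(E + 2i\<eta>)| \<le> Im S(E + i\<eta>). Summing over dyadic scales from
  \<eta> up to 1, where |S| \<le> 1 trivially, |S| is controlled by the values of Im S at O(log (1/\<eta>)) scales,
  to which the first estimate applies with \<mu> = 1.
\<close>

section \<open>Inverses and determinants of matrices with positive definite real part\<close>

text \<open>The size is separate from the entries, so a leading principal minor of \<open>K\<close>
  is \<open>K\<close> itself read at a smaller size.\<close>

definition detn :: "nat \<Rightarrow> (nat \<Rightarrow> nat \<Rightarrow> complex) \<Rightarrow> complex" where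
  "detn n K = Determinant.det (Matrix.mat n n (\<lambda>(i, j). K i j))"

lemma detn_cong:
  "(\<And>i j. i < n \<Longrightarrow> j < n \<Longrightarrow> K i j = L i j) \<Longrightarrow> detn n K = detn n L"
  unfolding detn_def by (rule arg_cong[where f = Determinant.det]) (auto intro!: eq_matI)

lemma detn_0 [simp]: "detn 0 K = 1"
  unfolding detn_def by (rule det_dim_zero) auto

lemma detn_one: "detn n (\<lambda>i j. if i = j then 1 else 0) = 1"
proof -
  have "Matrix.mat n n (\<lambda>(i, j). if i = j then 1 else 0) = (1\<^sub>m n :: complex mat)"
    by (auto intro!: eq_matI)
  then show ?thesis unfolding detn_def by simp
qed

lemma detn_mult: "detn n (\<lambda>i j. \<Sum>k<n. A i k * B k j) = detn n A * detn n B"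
proof -
  have "Matrix.mat n n (\<lambda>(i, j). \<Sum>k<n. A i k * B k j) =
      Matrix.mat n n (\<lambda>(i, j). A i j) * Matrix.mat n n (\<lambda>(i, j). B i j)"
    by (auto intro!: eq_matI simp: scalar_prod_def atLeast0LessThan)
  then show ?thesis
    unfolding detn_def by (simp add: det_mult[of _ n])
qed

lemma detn_last_row:
  assumes "\<And>j. j < n \<Longrightarrow> K n j = 0"
  shows "detn (Suc n) K = K n n * detn n K"
proof -
  let ?A = "Matrix.mat (Suc n) (Suc n) (\<lambda>(i, j). K i j)"
  have "mat_delete ?A n n = Matrix.mat n n (\<lambda>(i, j). K i j)"
    by (auto simp: mat_delete_def intro!: eq_matI)
  then have "cofactor ?A n n = detn n K"
    by (simp add: Determinant.cofactor_def detn_def)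
  then show ?thesis
    unfolding detn_def[of "Suc n"]
    by (subst laplace_expansion_row[where n = "Suc n" and i = n]) (auto simp: assms)
qed

lemma detn_last_col:
  assumes "\<And>i. i < n \<Longrightarrow> K i n = 0"
  shows "detn (Suc n) K = K n n * detn n K"
proof -
  let ?A = "Matrix.mat (Suc n) (Suc n) (\<lambda>(i, j). K i j)"
  have "mat_delete ?A n n = Matrix.mat n n (\<lambda>(i, j). K i j)"
    by (auto simp: mat_delete_def intro!: eq_matI)
  then have "cofactor ?A n n = detn n K"
    by (simp add: Determinant.cofactor_def detn_def)
  then show ?thesis
    unfolding detn_def[of "Suc n"]
    by (subst laplace_expansion_column[where n = "Suc n" and j = n]) (auto simp: assms)
qed

text \<open>Only indices below \<open>n\<close> are constrained, so the same \<open>G\<close>, read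
  at a smaller size, can be an inverse of a different matrix.\<close>

definition inverse_on :: "nat \<Rightarrow> (nat \<Rightarrow> nat \<Rightarrow> complex) \<Rightarrow> (nat \<Rightarrow> nat \<Rightarrow> complex) \<Rightarrow> bool" where
  "inverse_on n K G \<longleftrightarrow>
     (\<forall>i<n. \<forall>j<n. (\<Sum>k<n. K i k * G k j) = (if i = j then 1 else 0)) \<and>
     (\<forall>i<n. \<forall>j<n. (\<Sum>k<n. G i k * K k j) = (if i = j then 1 else 0))"

lemma inverse_on_sym: "inverse_on n K G \<Longrightarrow> inverse_on n G K"
  by (auto simp: inverse_on_def)

lemma inverse_onD:
  assumes "inverse_on n K G" "i < n" "j < n"
  shows "(\<Sum>k<n. K i k * G k j) = (if i = j then 1 else 0)"
  using assms by (auto simp: inverse_on_def)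

lemma inverse_on_unique:
  assumes KG: "inverse_on n K G" and KH: "inverse_on n K H" and ij: "i < n" "j < n"
  shows "G i j = H i j"
proof -
  have "(\<Sum>k<n. G i k * (\<Sum>l<n. K k l * H l j)) = (\<Sum>l<n. (\<Sum>k<n. G i k * K k l) * H l j)"
    unfolding sum_distrib_left sum_distrib_right
    by (subst sum.swap) (simp add: mult.assoc)
  moreover have "(\<Sum>k<n. G i k * (\<Sum>l<n. K k l * H l j)) = (\<Sum>k<n. G i k * (if k = j then 1 else 0))"
    by (rule sum.cong) (use inverse_onD[OF KH] ij in auto)
  moreover have "(\<Sum>l<n. (\<Sum>k<n. G i k * K k l) * H l j) = (\<Sum>l<n. (if i = l then 1 else 0) * H l j)"
    by (rule sum.cong) (use inverse_onD[OF inverse_on_sym[OF KG]] ij in auto)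
  moreover have "(\<Sum>k<n. G i k * (if k = j then 1 else 0)) = G i j"
    using ij by (simp add: if_distrib cong: if_cong)
  moreover have "(\<Sum>l<n. (if i = l then 1 else 0) * H l j) = H i j"
    using ij by (simp add: if_distrib[of "\<lambda>x. x * _"] cong: if_cong)
  ultimately show ?thesis by simp
qed

text \<open>Cramer's rule. As an explicit quotient of determinants it makes the inverse a measurable
  function of the entries.\<close>

definition inv_entry :: "nat \<Rightarrow> (nat \<Rightarrow> nat \<Rightarrow> complex) \<Rightarrow> nat \<Rightarrow> nat \<Rightarrow> complex" where
  "inv_entry n K i j = cofactor (Matrix.mat n n (\<lambda>(i, j). K i j)) j i / detn n K"

lemma inverse_on_inv_entry:
  assumes "detn n K \<noteq> 0"
  shows "inverse_on n K (inv_entry n K)"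
proof -
  let ?A = "Matrix.mat n n (\<lambda>(i, j). K i j)"
  have A: "?A \<in> carrier_mat n n" by simp
  have adj: "adj_mat ?A $$ (i, j) = inv_entry n K i j * detn n K" if "i < n" "j < n" for i j
    using that assms by (simp add: adj_mat_def inv_entry_def)
  have "(\<Sum>k<n. K i k * inv_entry n K k j) = (if i = j then 1 else 0)" if ij: "i < n" "j < n" for i j
  proof -
    have "(?A * adj_mat ?A) $$ (i, j) = (\<Sum>k<n. K i k * (inv_entry n K k j * detn n K))"
      using ij adj_mat(1)[OF A]
      by (auto simp: scalar_prod_def atLeast0LessThan adj intro!: sum.cong)
    also have "\<dots> = (\<Sum>k<n. K i k * inv_entry n K k j) * detn n K"
      by (simp add: sum_distrib_right mult.assoc)
    finally show ?thesis
      using ij assms unfolding adj_mat(2)[OF A] by (auto simp: detn_def split: if_splits)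
  qed
  moreover have "(\<Sum>k<n. inv_entry n K i k * K k j) = (if i = j then 1 else 0)" if ij: "i < n" "j < n" for i j
  proof -
    have "(adj_mat ?A * ?A) $$ (i, j) = (\<Sum>k<n. inv_entry n K i k * detn n K * K k j)"
      using ij adj_mat(1)[OF A]
      by (auto simp: scalar_prod_def atLeast0LessThan adj intro!: sum.cong)
    also have "\<dots> = (\<Sum>k<n. inv_entry n K i k * K k j) * detn n K"
      by (simp add: sum_distrib_left sum_distrib_right mult_ac)
    finally show ?thesis
      using ij assms unfolding adj_mat(3)[OF A] by (auto simp: detn_def split: if_splits)
  qed
  ultimately show ?thesis by (auto simp: inverse_on_def)
qed

section \<open>Schur complements and block inversion\<close>

definition schur :: "nat \<Rightarrow> (nat \<Rightarrow> nat \<Rightarrow> complex) \<Rightarrow> nat \<Rightarrow> nat \<Rightarrow> complex" where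
  "schur n K i j = K i j - K i n * K n j / K n n"

text \<open>Block elimination of the last index: \<open>K\<close> is the product of the unit upper
  triangular \<open>A\<close> and of \<open>B\<close>, whose last column vanishes above the
  corner.\<close>

lemma detn_schur:
  assumes "K n n \<noteq> 0"
  shows "detn (Suc n) K = K n n * detn n (schur n K)"
proof -
  define A where "A i k = (if i = k then 1 else if k = n then K i n / K n n else 0)" for i k
  define B where "B i j = (if j = n then if i = n then K n n else 0
    else if i = n then K n j else schur n K i j)" for i j
  have "(\<Sum>k<Suc n. A i k * B k j) = K i j" if ij: "i < Suc n" "j < Suc n" for i j
  proof (cases "i = n")
    case True
    then have "(\<Sum>k<n. A i k * B k j) = 0"
      by (intro sum.neutral) (auto simp: A_def)
    then show ?thesis using True by (simp add: A_def B_def)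
  next
    case False
    then have i: "i < n" using ij by simp
    have "(\<Sum>k<n. A i k * B k j) = (\<Sum>k<n. if i = k then B i j else 0)"
      by (rule sum.cong) (auto simp: A_def)
    also have "\<dots> = B i j" using i by simp
    finally show ?thesis
      using i False assms by (auto simp: A_def B_def schur_def)
  qed
  then have "detn (Suc n) K = detn (Suc n) A * detn (Suc n) B"
    unfolding detn_mult[symmetric] by (intro detn_cong) simp
  also have "detn (Suc n) A = A n n * detn n A"
    by (rule detn_last_row) (auto simp: A_def)
  also have "detn n A = detn n (\<lambda>i j. if i = j then 1 else 0)"
    by (rule detn_cong) (auto simp: A_def)
  also have "detn (Suc n) B = B n n * detn n B"
    by (rule detn_last_col) (auto simp: B_def)
  also have "detn n B = detn n (schur n K)"
    by (rule detn_cong) (auto simp: B_def)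
  finally show ?thesis by (simp add: A_def B_def detn_one)
qed

text \<open>Elimination of the leading block instead: \<open>A\<close> keeps that block and the last
  row, \<open>B\<close> is unit upper triangular, and \<open>s\<close> is the Schur complement left
  in the corner. Together with \<open>detn_schur\<close> this evaluates one determinant in two
  ways.\<close>

lemma detn_bordered:
  assumes Z: "inverse_on n K Z"
  shows "detn (Suc n) K = detn n K * (K n n - (\<Sum>i<n. \<Sum>j<n. K n i * Z i j * K j n))"
proof -
  define s where "s = K n n - (\<Sum>i<n. \<Sum>j<n. K n i * Z i j * K j n)"
  define A where "A i k = (if k = n then if i = n then s else 0 else K i k)" for i k
  define B where "B k j = (if k = j then 1 else if j = n then (\<Sum>l<n. Z k l * K l n) else 0)" for k j
  have "(\<Sum>k<Suc n. A i k * B k j) = K i j" if ij: "i < Suc n" "j < Suc n" for i j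
  proof (cases "j = n")
    case False
    then have j: "j < n" using ij by simp
    have "(\<Sum>k<n. A i k * B k j) = (\<Sum>k<n. if k = j then A i j else 0)"
      by (rule sum.cong) (use False in \<open>auto simp: B_def\<close>)
    also have "\<dots> = A i j" using j by simp
    finally show ?thesis using False by (auto simp: A_def B_def)
  next
    case j: True
    have *: "(\<Sum>k<n. A i k * B k j) = (\<Sum>k<n. \<Sum>l<n. K i k * Z k l * K l n)"
      by (rule sum.cong) (auto simp: A_def B_def j sum_distrib_left mult.assoc)
    show ?thesis
    proof (cases "i = n")
      case True
      then show ?thesis using * j by (simp add: A_def B_def s_def)
    next
      case False
      then have i: "i < n" using ij by simp
      have "(\<Sum>k<n. \<Sum>l<n. K i k * Z k l * K l n) = (\<Sum>l<n. (\<Sum>k<n. K i k * Z k l) * K l n)"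
        unfolding sum_distrib_right by (rule sum.swap)
      also have "\<dots> = (\<Sum>l<n. if i = l then K i n else 0)"
        by (rule sum.cong) (use inverse_onD[OF Z i] in auto)
      also have "\<dots> = K i n" using i by simp
      finally show ?thesis using * j False by (simp add: A_def B_def)
    qed
  qed
  then have "detn (Suc n) K = detn (Suc n) A * detn (Suc n) B"
    unfolding detn_mult[symmetric] by (intro detn_cong) simp
  also have "detn (Suc n) A = A n n * detn n A"
    by (rule detn_last_col) (auto simp: A_def)
  also have "detn n A = detn n K"
    by (rule detn_cong) (auto simp: A_def)
  also have "detn (Suc n) B = B n n * detn n B"
    by (rule detn_last_row) (auto simp: B_def)
  also have "detn n B = detn n (\<lambda>i j. if i = j then 1 else 0)"
    by (rule detn_cong) (auto simp: B_def)
  finally show ?thesis by (simp add: A_def B_def detn_one s_def)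
qed

text \<open>The equations of index \<open>n\<close> in K G = 1 and G K = 1 turn the correction in
  \<open>schur\<close> into the boundary term missing from the sums over k < n. Exchanging
  \<open>K\<close> and \<open>G\<close> gives the dual fact: a leading minor is inverted by the
  Schur complement of the inverse.\<close>

lemma inverse_on_schur:
  assumes inv: "inverse_on (Suc n) K G" and nz: "K n n \<noteq> 0"
  shows "inverse_on n (schur n K) G"
proof -
  have KG: "(\<Sum>k<n. K i k * G k j) = (if i = j then 1 else 0) - K i n * G n j"
    if "i \<le> n" "j \<le> n" for i j
    using inverse_onD[OF inv, of i j] that by (auto simp: algebra_simps)
  have GK: "(\<Sum>k<n. G i k * K k j) = (if i = j then 1 else 0) - G i n * K n j"
    if "i \<le> n" "j \<le> n" for i j
    using inverse_onD[OF inverse_on_sym[OF inv], of i j] that by (auto simp: algebra_simps)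
  have "(\<Sum>k<n. schur n K i k * G k j) = (if i = j then 1 else 0)" if "i < n" "j < n" for i j
  proof -
    have "(\<Sum>k<n. schur n K i k * G k j) =
        (\<Sum>k<n. K i k * G k j) - K i n / K n n * (\<Sum>k<n. K n k * G k j)"
      by (simp add: schur_def sum_distrib_left left_diff_distrib right_diff_distrib sum_subtractf mult_ac)
    then show ?thesis using that nz by (simp add: KG)
  qed
  moreover have "(\<Sum>k<n. G i k * schur n K k j) = (if i = j then 1 else 0)" if "i < n" "j < n" for i j
  proof -
    have "(\<Sum>k<n. G i k * schur n K k j) =
        (\<Sum>k<n. G i k * K k j) - (\<Sum>k<n. G i k * K k n) * (K n j / K n n)"
      by (simp add: schur_def sum_distrib_right right_diff_distrib sum_subtractf sum_divide_distrib mult.assoc)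
    then show ?thesis using that nz by (simp add: GK)
  qed
  ultimately show ?thesis by (auto simp: inverse_on_def)
qed

text \<open>The first \<open>n\<close> equations for the last column of \<open>G\<close>, solved
  with \<open>R\<close>, express that column through its corner; the last equation then becomes a
  scalar one.\<close>

lemma inverse_on_corner:
  assumes inv: "inverse_on (Suc n) K G" and R: "inverse_on n K R"
  shows "G n n * (K n n - (\<Sum>i<n. \<Sum>j<n. K n i * R i j * K j n)) = 1"
proof -
  have KG: "(\<Sum>k<n. K i k * G k n) = (if i = n then 1 else 0) - K i n * G n n"
    if "i \<le> n" for i
    using inverse_onD[OF inv, of i n] that by (auto simp: algebra_simps)
  have G: "G i n = - (\<Sum>j<n. R i j * K j n) * G n n" if i: "i < n" for i
  proof -
    have "(\<Sum>j<n. R i j * (\<Sum>k<n. K j k * G k n)) = (\<Sum>k<n. (\<Sum>j<n. R i j * K j k) * G k n)"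
      unfolding sum_distrib_left sum_distrib_right by (subst sum.swap) (simp add: mult.assoc)
    also have "\<dots> = (\<Sum>k<n. if i = k then G i n else 0)"
      by (rule sum.cong) (use inverse_onD[OF inverse_on_sym[OF R] i] in auto)
    also have "\<dots> = G i n" using i by simp
    also have "(\<Sum>j<n. R i j * (\<Sum>k<n. K j k * G k n)) = (\<Sum>j<n. R i j * (- K j n * G n n))"
      by (rule sum.cong) (auto simp: KG)
    finally show ?thesis by (simp add: sum_distrib_right sum_negf mult.assoc)
  qed
  have "(\<Sum>k<n. K n k * G k n) = (\<Sum>k<n. K n k * (- (\<Sum>j<n. R k j * K j n) * G n n))"
    by (rule sum.cong) (auto simp: G)
  also have "\<dots> = - (\<Sum>i<n. \<Sum>j<n. K n i * R i j * K j n) * G n n"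
    by (simp add: sum_distrib_left sum_distrib_right sum_negf mult.assoc)
  finally show ?thesis using KG[of n] by (simp add: algebra_simps)
qed

section \<open>Matrices with positive definite Hermitian part\<close>

definition qform :: "nat \<Rightarrow> (nat \<Rightarrow> nat \<Rightarrow> complex) \<Rightarrow> (nat \<Rightarrow> complex) \<Rightarrow> complex" where
  "qform n K \<xi> = (\<Sum>i<n. \<Sum>j<n. cnj (\<xi> i) * K i j * \<xi> j)"

text \<open>The real part of the form of \<open>K\<close> is the form of its Hermitian part, so this
  is positive definiteness of the Hermitian part; \<open>K\<close> itself may be
  non-Hermitian.\<close>

definition accretive :: "nat \<Rightarrow> (nat \<Rightarrow> nat \<Rightarrow> complex) \<Rightarrow> bool" where
  "accretive n K \<longleftrightarrow> (\<forall>\<xi>. (\<exists>i<n. \<xi> i \<noteq> 0) \<longrightarrow> 0 < Re (qform n K \<xi>))"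

lemma qform_Suc:
  "qform (Suc n) K \<xi> = qform n K \<xi> + (\<Sum>i<n. cnj (\<xi> i) * K i n) * \<xi> n
     + cnj (\<xi> n) * ((\<Sum>j<n. K n j * \<xi> j) + K n n * \<xi> n)"
  by (simp add: qform_def sum.distrib sum_distrib_left sum_distrib_right algebra_simps)

lemma qform_cong:
  "(\<And>i. i < n \<Longrightarrow> \<xi> i = \<zeta> i) \<Longrightarrow> qform n K \<xi> = qform n K \<zeta>"
  by (simp add: qform_def)

lemma accretiveD: "accretive n K \<Longrightarrow> i < n \<Longrightarrow> \<xi> i \<noteq> 0 \<Longrightarrow> 0 < Re (qform n K \<xi>)"
  by (auto simp: accretive_def)

lemma accretive_Re_nonneg:
  assumes "accretive n K"
  shows "0 \<le> Re (qform n K \<xi>)"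
proof (cases "\<exists>i<n. \<xi> i \<noteq> 0")
  case True
  then show ?thesis using assms accretiveD by (meson less_imp_le)
next
  case False
  then have "qform n K \<xi> = 0" by (simp add: qform_def)
  then show ?thesis by simp
qed

lemma accretive_minor:
  assumes "accretive (Suc n) K"
  shows "accretive n K"
  unfolding accretive_def
proof (intro allI impI, elim exE conjE)
  fix \<xi> :: "nat \<Rightarrow> complex" and i assume i: "i < n" "\<xi> i \<noteq> 0"
  have "0 < Re (qform (Suc n) K (\<xi>(n := 0)))"
    by (rule accretiveD[OF assms, of i]) (use i in auto)
  also have "qform (Suc n) K (\<xi>(n := 0)) = qform n K \<xi>"
    by (subst qform_Suc) (auto intro: qform_cong)
  finally show "0 < Re (qform n K \<xi>)" .
qed

lemma accretive_corner:
  assumes "accretive (Suc n) K"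
  shows "0 < Re (K n n)"
proof -
  let ?e = "\<lambda>i. if i = n then 1 else 0 :: complex"
  have "qform n K ?e = 0" by (simp add: qform_def)
  then have "qform (Suc n) K ?e = K n n" by (simp add: qform_Suc)
  moreover have "0 < Re (qform (Suc n) K ?e)" by (rule accretiveD[OF assms, of n]) auto
  ultimately show ?thesis by simp
qed

lemma accretive_corner_nz: "accretive (Suc n) K \<Longrightarrow> K n n \<noteq> 0"
  using accretive_corner[of n K] by auto

text \<open>The vector is extended by the coordinate \<open>x\<close> that makes the last entry of K
  times the vector vanish; the form of \<open>K\<close> at the extension is then the form of the
  Schur complement.\<close>

lemma accretive_schur:
  assumes "accretive (Suc n) K"
  shows "accretive n (schur n K)"
  unfolding accretive_def
proof (intro allI impI, elim exE conjE)
  fix \<xi> :: "nat \<Rightarrow> complex" and i assume i: "i < n" "\<xi> i \<noteq> 0"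
  define x where "x = - (\<Sum>j<n. K n j * \<xi> j) / K n n"
  have nz: "K n n \<noteq> 0" by (rule accretive_corner_nz[OF assms])
  have "qform n (schur n K) \<xi> = qform n K \<xi> - (\<Sum>i<n. \<Sum>j<n. cnj (\<xi> i) * (K i n * K n j / K n n) * \<xi> j)"
    by (simp add: qform_def schur_def sum_subtractf right_diff_distrib left_diff_distrib)
  also have "(\<Sum>i<n. \<Sum>j<n. cnj (\<xi> i) * (K i n * K n j / K n n) * \<xi> j) =
      (\<Sum>i<n. cnj (\<xi> i) * K i n) * ((\<Sum>j<n. K n j * \<xi> j) / K n n)"
    by (simp add: sum_distrib_left sum_distrib_right sum_divide_distrib mult_ac)
      (rule sum.swap)
  also have "qform n K \<xi> - \<dots> = qform n K \<xi> + (\<Sum>i<n. cnj (\<xi> i) * K i n) * x"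
    by (simp add: x_def)
  also have "\<dots> = qform (Suc n) K (\<xi>(n := x))"
    using nz qform_cong[of n \<xi> "\<xi>(n := x)" K] by (simp add: qform_Suc x_def)
  finally have eq: "qform n (schur n K) \<xi> = qform (Suc n) K (\<xi>(n := x))" .
  show "0 < Re (qform n (schur n K) \<xi>)"
    unfolding eq by (rule accretiveD[OF assms, of i]) (use i in auto)
qed

text \<open>Each elimination splits off a nonzero corner and leaves an accretive matrix.\<close>

lemma accretive_detn_nz: "accretive n K \<Longrightarrow> detn n K \<noteq> 0"
proof (induction n arbitrary: K)
  case (Suc n)
  then show ?case
    using accretive_schur[OF Suc.prems] accretive_corner_nz[OF Suc.prems] by (simp add: detn_schur)
qed simp

lemma accretive_inverse_on: "accretive n K \<Longrightarrow> inverse_on n K (inv_entry n K)"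
  by (intro inverse_on_inv_entry accretive_detn_nz)

text \<open>Substituting \<zeta> = G \<xi>, the form of \<open>G\<close> at \<xi> is the conjugate
  of the form of \<open>K\<close> at \<zeta>, and \<zeta> is nonzero because \<xi> = K \<zeta>
  is.\<close>

lemma accretive_inverse:
  assumes K: "accretive n K" and inv: "inverse_on n K G"
  shows "accretive n G"
  unfolding accretive_def
proof (intro allI impI, elim exE conjE)
  fix \<xi> :: "nat \<Rightarrow> complex" and i assume i: "i < n" "\<xi> i \<noteq> 0"
  define \<zeta> where "\<zeta> i = (\<Sum>j<n. G i j * \<xi> j)" for i
  have \<xi>: "\<xi> i = (\<Sum>j<n. K i j * \<zeta> j)" if "i < n" for i
  proof -
    have "(\<Sum>j<n. K i j * \<zeta> j) = (\<Sum>k<n. (\<Sum>j<n. K i j * G j k) * \<xi> k)"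
      unfolding \<zeta>_def sum_distrib_left sum_distrib_right by (subst sum.swap) (simp add: mult.assoc)
    also have "\<dots> = (\<Sum>k<n. if i = k then \<xi> i else 0)"
      by (rule sum.cong) (use inverse_onD[OF inv that] in auto)
    finally show ?thesis using that by simp
  qed
  have "qform n G \<xi> = (\<Sum>i<n. cnj (\<xi> i) * \<zeta> i)"
    by (simp add: qform_def \<zeta>_def sum_distrib_left mult.assoc)
  also have "\<dots> = (\<Sum>i<n. cnj (\<Sum>j<n. K i j * \<zeta> j) * \<zeta> i)"
    by (rule sum.cong) (auto simp: \<xi>)
  also have "\<dots> = cnj (qform n K \<zeta>)"
    by (simp add: qform_def sum_distrib_left sum_distrib_right mult_ac)
  finally have eq: "Re (qform n G \<xi>) = Re (qform n K \<zeta>)" by simp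
  have "\<exists>j<n. \<zeta> j \<noteq> 0"
  proof (rule ccontr)
    assume "\<not> ?thesis"
    then have "(\<Sum>j<n. K i j * \<zeta> j) = 0" by (intro sum.neutral) auto
    then show False using \<xi>[of i] i by simp
  qed
  then show "0 < Re (qform n G \<xi>)"
    unfolding eq using K accretiveD by blast
qed

section \<open>Determinants of positive definite Hermitian matrices\<close>

definition hermitian_on :: "nat \<Rightarrow> (nat \<Rightarrow> nat \<Rightarrow> complex) \<Rightarrow> bool" where
  "hermitian_on n K \<longleftrightarrow> (\<forall>i<n. \<forall>j<n. cnj (K i j) = K j i)"

text \<open>The corner is real and positive and the Schur complement inherits both hypotheses, so
  the determinant is a product of positive numbers.\<close>

lemma posdef_detn:
  "hermitian_on n K \<Longrightarrow> accretive n K \<Longrightarrow> 0 < Re (detn n K) \<and> Im (detn n K) = 0"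
proof (induction n arbitrary: K)
  case (Suc n)
  have herm: "cnj (K i j) = K j i" if "i \<le> n" "j \<le> n" for i j
    using Suc.prems(1) that by (simp add: hermitian_on_def)
  have "hermitian_on n (schur n K)"
    unfolding hermitian_on_def schur_def
  proof (intro allI impI)
    fix i j assume "i < n" "j < n"
    then show "cnj (K i j - K i n * K n j / K n n) = K j i - K j n * K n i / K n n"
      by (simp add: herm mult.commute)
  qed
  with Suc have IH: "0 < Re (detn n (schur n K))" "Im (detn n (schur n K)) = 0"
    using accretive_schur by auto
  have c: "0 < Re (K n n)" by (rule accretive_corner[OF Suc.prems(2)])
  have "cnj (K n n) = K n n" using herm by blast
  then have i: "Im (K n n) = 0" by (simp add: complex_eq_iff)
  show ?case
    using IH c i accretive_corner_nz[OF Suc.prems(2)] by (simp add: detn_schur)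
qed simp

text \<open>The matrix determinant lemma: the left determinant is det P times 1 minus the form of
  the inverse of \<open>P\<close> at \<open>q\<close>, and that form is nonnegative.\<close>

lemma Re_detn_rank_one_le:
  assumes herm: "hermitian_on n P" and acc: "accretive n P"
  shows "Re (detn n (\<lambda>i j. P i j - q i * cnj (q j))) \<le> Re (detn n P)"
proof -
  \<comment> \<open>\<open>P\<close> bordered by \<open>q\<close>, its adjoint and a corner 1.
    \<open>detn_schur\<close> reads the determinant as that of the rank-one perturbation,
    \<open>detn_bordered\<close> as det P times a scalar.\<close>
  define K where "K i j = (if i = n then if j = n then 1 else cnj (q j)
     else if j = n then q i else P i j)" for i j
  have KP: "detn n K = detn n P" by (rule detn_cong) (auto simp: K_def)
  have inv: "inverse_on n K (inv_entry n P)"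
    using accretive_inverse_on[OF acc] by (auto simp: inverse_on_def K_def)
  have "detn n (\<lambda>i j. P i j - q i * cnj (q j)) = detn n (schur n K)"
    by (rule detn_cong) (auto simp: K_def schur_def)
  also have "\<dots> = detn (Suc n) K"
    by (subst detn_schur) (auto simp: K_def)
  also have "\<dots> = detn n P * (1 - (\<Sum>i<n. \<Sum>j<n. K n i * inv_entry n P i j * K j n))"
    by (subst detn_bordered[OF inv]) (simp add: KP, simp add: K_def)
  also have "(\<Sum>i<n. \<Sum>j<n. K n i * inv_entry n P i j * K j n) = qform n (inv_entry n P) q"
    by (simp add: qform_def K_def)
  finally have eq: "detn n (\<lambda>i j. P i j - q i * cnj (q j)) = detn n P * (1 - qform n (inv_entry n P) q)" .
  have "0 \<le> Re (qform n (inv_entry n P) q)"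
    by (intro accretive_Re_nonneg accretive_inverse[OF acc] accretive_inverse_on[OF acc])
  then show ?thesis
    unfolding eq using posdef_detn[OF herm acc] by (simp add: mult_left_le)
qed

section \<open>The recursive inequality for det (1 + t Re G)\<close>

text \<open>Here Re G is the Hermitian part of \<open>G\<close>, not the matrix of real parts of its
  entries.\<close>

definition one_plus_re :: "real \<Rightarrow> (nat \<Rightarrow> nat \<Rightarrow> complex) \<Rightarrow> nat \<Rightarrow> nat \<Rightarrow> complex" where
  "one_plus_re t G i j = (if i = j then 1 else 0) + of_real t * ((G i j + cnj (G j i)) / 2)"

lemma hermitian_one_plus_re: "hermitian_on n (one_plus_re t G)"
  by (auto simp: hermitian_on_def one_plus_re_def)

lemma accretive_one_plus_re:
  assumes G: "accretive n G" and t: "0 \<le> t"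
  shows "accretive n (one_plus_re t G)"
  unfolding accretive_def
proof (intro allI impI, elim exE conjE)
  fix \<xi> :: "nat \<Rightarrow> complex" and i assume i: "i < n" "\<xi> i \<noteq> 0"
  have adj: "(\<Sum>i<n. \<Sum>j<n. cnj (\<xi> i) * cnj (G j i) * \<xi> j) = cnj (qform n G \<xi>)"
    unfolding qform_def by (subst sum.swap) (simp add: mult_ac)
  have one: "(\<Sum>i<n. \<Sum>j<n. cnj (\<xi> i) * (if i = j then 1 else 0) * \<xi> j) = (\<Sum>i<n. of_real ((cmod (\<xi> i))\<^sup>2))"
    by (intro sum.cong refl) (simp add: if_distrib if_distribR complex_norm_square mult.commute del: of_real_power cong: if_cong)
  have "qform n (one_plus_re t G) \<xi> =
     (\<Sum>i<n. \<Sum>j<n. cnj (\<xi> i) * (if i = j then 1 else 0) * \<xi> j) +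
     of_real t / 2 * (qform n G \<xi> + (\<Sum>i<n. \<Sum>j<n. cnj (\<xi> i) * cnj (G j i) * \<xi> j))"
    unfolding qform_def one_plus_re_def sum_distrib_left sum.distrib[symmetric]
    by (intro sum.cong refl) (simp add: field_simps)
  then have "Re (qform n (one_plus_re t G) \<xi>) = (\<Sum>i<n. (cmod (\<xi> i))\<^sup>2) + t * Re (qform n G \<xi>)"
    by (simp add: adj one)
  moreover have "0 < (\<Sum>i<n. (cmod (\<xi> i))\<^sup>2)"
    by (rule sum_pos2[of _ i]) (use i in auto)
  moreover have "0 \<le> t * Re (qform n G \<xi>)"
    using t accretive_Re_nonneg[OF G] by simp
  ultimately show "0 < Re (qform n (one_plus_re t G) \<xi>)" by linarith
qed

text \<open>The variables \<open>h\<close>, \<open>u\<close>, \<open>w\<close> stand for the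
  conjugates of g, y, x'. Treating them as independent leaves, after clearing denominators, a
  polynomial identity.\<close>

lemma rank_one_scalar_identity_aux:
  fixes g h x u w z :: complex
  assumes "g \<noteq> 0" "h \<noteq> 0" "g + h \<noteq> 0"
  shows "(x + u) / 2 * (w + z) / 2 / ((g + h) / 2) =
    (x * z / g + w * u / h) / 2 + g * h / (2 * (g + h)) * ((u / h - x / g) * (z / g - w / h))"
proof -
  have "g * h / (2 * (g + h)) * ((u / h - x / g) * (z / g - w / h)) =
      (u * g - x * h) * (z * h - w * g) / (2 * (g + h) * (g * h))"
    using assms by (simp add: diff_frac_eq)
  moreover have "(x * z / g + w * u / h) / 2 = (x * z * h + w * u * g) / (2 * (g * h))"
    using assms by (simp add: add_frac_eq)
  then have "(x * z / g + w * u / h) / 2 =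
      (x * z * h + w * u * g) * (g + h) / (2 * (g + h) * (g * h))"
    using nonzero_mult_divide_mult_cancel_right[OF assms(3), of "x * z * h + w * u * g" "2 * (g * h)"]
    by (simp only: mult_ac)
  moreover have "(x + u) / 2 * (w + z) / 2 / ((g + h) / 2) =
      (x + u) * (w + z) * (g * h) / (2 * (g + h) * (g * h))"
    using assms by simp
  moreover have "(x + u) * (w + z) * (g * h) =
      (x * z * h + w * u * g) * (g + h) + (u * g - x * h) * (z * h - w * g)"
    by (simp add: algebra_simps)
  ultimately show ?thesis
    by (simp add: add_divide_distrib)
qed

text \<open>With g = G_{nn}, the real part of the Schur complement of G exceeds the Schur complement of
  the real part of G by the rank-one matrix q q^*, q_i = |g| / (2 sqrt (Re g)) (cnj G_{ni} / cnj g - G_{in} / g).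
  This is the entry (i, j) of that identity.\<close>

lemma rank_one_scalar_identity:
  fixes g x y x' y' :: complex
  assumes "0 < Re g"
  shows "(x + cnj y) / 2 * (cnj x' + y') / 2 / of_real (Re g) =
    (x * y' / g + cnj (x' * y / g)) / 2
    + of_real (cmod g / (2 * sqrt (Re g))) * (cnj y / cnj g - x / g) *
      cnj (of_real (cmod g / (2 * sqrt (Re g))) * (cnj y' / cnj g - x' / g))"
proof -
  have nz: "g \<noteq> 0" "cnj g \<noteq> 0" "g + cnj g \<noteq> 0"
    using assms by (auto simp: complex_eq_iff)
  \<comment> \<open>The coefficient of q occurs only squared, and its square is rational in g and
    \<open>cnj g\<close>, so the square root disappears.\<close>
  have sq: "complex_of_real (cmod g / (2 * sqrt (Re g))) * of_real (cmod g / (2 * sqrt (Re g))) =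
      g * cnj g / (2 * (g + cnj g))"
  proof -
    have "cmod g / (2 * sqrt (Re g)) * (cmod g / (2 * sqrt (Re g))) = (cmod g)\<^sup>2 / (4 * Re g)"
      using assms by (simp add: power2_eq_square)
    then have "complex_of_real (cmod g / (2 * sqrt (Re g))) * of_real (cmod g / (2 * sqrt (Re g))) =
      of_real ((cmod g)\<^sup>2) / of_real (4 * Re g)"
      by (metis of_real_divide of_real_mult)
    also have "of_real ((cmod g)\<^sup>2) = g * cnj g" by (rule complex_norm_square)
    also have "of_real (4 * Re g) = 2 * (g + cnj g)" by (simp add: complex_add_cnj)
    finally show ?thesis .
  qed
  have re: "complex_of_real (Re g) = (g + cnj g) / 2" by (simp add: complex_add_cnj)
  define h where "h = cnj g"
  have "of_real (cmod g / (2 * sqrt (Re g))) * (cnj y / cnj g - x / g) *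
      cnj (of_real (cmod g / (2 * sqrt (Re g))) * (cnj y' / cnj g - x' / g)) =
     (complex_of_real (cmod g / (2 * sqrt (Re g))) * of_real (cmod g / (2 * sqrt (Re g)))) *
      ((cnj y / cnj g - x / g) * (y' / g - cnj x' / cnj g))"
    by (simp add: mult_ac)
  also have "\<dots> = g * h / (2 * (g + h)) * ((cnj y / h - x / g) * (y' / g - cnj x' / h))"
    unfolding sq h_def ..
  finally have eq: "of_real (cmod g / (2 * sqrt (Re g))) * (cnj y / cnj g - x / g) *
      cnj (of_real (cmod g / (2 * sqrt (Re g))) * (cnj y' / cnj g - x' / g)) =
      g * h / (2 * (g + h)) * ((cnj y / h - x / g) * (y' / g - cnj x' / h))" .
  show ?thesis
    unfolding eq re
    using rank_one_scalar_identity_aux[of g h x "cnj y" "cnj x'" y'] nz by (simp add: h_def)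
qed

text \<open>The determinant is affine in its corner entry 1 + t Re g. The summand 1 contributes the
  leading minor; the summand t Re g contributes itself times a Schur complement, which is 1 + t Re
  of \<open>schur n G\<close> minus a rank-one matrix that can only lower the determinant.\<close>

lemma detn_one_plus_re_step:
  assumes G: "accretive (Suc n) G" and t: "0 \<le> t"
  shows "Re (detn (Suc n) (one_plus_re t G)) \<le>
    Re (detn n (one_plus_re t G)) + t * Re (G n n) * Re (detn n (one_plus_re t (schur n G)))"
\<comment> \<open>The case is separate because the corner t Re g must be nonzero for the Schur
  complement below.\<close>
proof (cases "t = 0")
  case True
  then have "one_plus_re t G' = (\<lambda>i j. if i = j then 1 else 0)" for G'
    by (auto simp: one_plus_re_def fun_eq_iff)
  then show ?thesis using True by (simp add: detn_one)
next
  case False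
  with t have t0: "0 < t" by simp
  define P where "P = one_plus_re t G"
  define g where "g = G n n"
  have g: "0 < Re g" unfolding g_def by (rule accretive_corner[OF G])
  \<comment> \<open>\<open>P0\<close> is \<open>P\<close> with the summand 1 removed from the
    corner.\<close>
  define P0 where "P0 i j = (if i = n \<and> j = n then of_real (t * Re g) else P i j)" for i j
  have G': "accretive n (schur n G)" by (rule accretive_schur[OF G])
  have Pn: "accretive n P"
    unfolding P_def by (intro accretive_one_plus_re accretive_minor[OF G] t)
  have inv: "inverse_on n P (inv_entry n P)" by (rule accretive_inverse_on[OF Pn])
  then have inv0: "inverse_on n P0 (inv_entry n P)" by (auto simp: inverse_on_def P0_def)
  have PP0: "detn n P0 = detn n P" by (rule detn_cong) (auto simp: P0_def)
  have Pnn: "P n n = 1 + of_real (t * Re g)"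
    by (simp add: P_def one_plus_re_def g_def complex_add_cnj)
  have "detn (Suc n) P = detn n P + detn (Suc n) P0"
    unfolding detn_bordered[OF inv] detn_bordered[OF inv0]
    by (simp add: PP0 Pnn) (simp add: P0_def algebra_simps)
  also have "detn (Suc n) P0 = of_real (t * Re g) * detn n (schur n P0)"
    using t0 g by (subst detn_schur) (auto simp: P0_def)
  finally have split: "Re (detn (Suc n) P) = Re (detn n P) + t * Re g * Re (detn n (schur n P0))"
    by simp
  \<comment> \<open>The vector of \<open>rank_one_scalar_identity\<close>, scaled by sqrt t so that
    its rank-one matrix carries the factor t.\<close>
  define q where "q i = of_real (sqrt t) * (of_real (cmod g / (2 * sqrt (Re g))) * (cnj (G n i) / cnj g - G i n / g))" for i
  have "detn n (schur n P0) = detn n (\<lambda>i j. one_plus_re t (schur n G) i j - q i * cnj (q j))"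
  proof (rule detn_cong)
    fix i j assume ij: "i < n" "j < n"
    have tt: "complex_of_real (sqrt t) * of_real (sqrt t) = of_real t"
      using t by (simp flip: of_real_mult)
    let ?c = "of_real (cmod g / (2 * sqrt (Re g)))"
    have "q i * cnj (q j) = of_real t * (?c * (cnj (G n i) / cnj g - G i n / g) *
      cnj (?c * (cnj (G n j) / cnj g - G j n / g)))"
      unfolding q_def tt[symmetric] by (simp add: mult_ac)
    also have "\<dots> = of_real t * ((G i n + cnj (G n i)) / 2 * (cnj (G j n) + G n j) / 2 / of_real (Re g)
       - (G i n * G n j / g + cnj (G j n * G n i / g)) / 2)"
      by (subst rank_one_scalar_identity[OF g]) simp
    finally have q: "q i * cnj (q j) = of_real t * ((G i n + cnj (G n i)) / 2 * (cnj (G j n) + G n j) / 2 / of_real (Re g)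
       - (G i n * G n j / g + cnj (G j n * G n i / g)) / 2)" .
    have "schur n P0 i j = (if i = j then 1 else 0) + of_real t * ((G i j + cnj (G j i)) / 2)
       - of_real t * ((G i n + cnj (G n i)) / 2 * (cnj (G j n) + G n j) / 2 / of_real (Re g))"
      using ij t0 g by (simp add: schur_def P0_def P_def one_plus_re_def g_def field_simps)
    moreover have "one_plus_re t (schur n G) i j = (if i = j then 1 else 0)
       + of_real t * ((G i j + cnj (G j i)) / 2)
       - of_real t * ((G i n * G n j / g + cnj (G j n * G n i / g)) / 2)"
      by (simp add: schur_def one_plus_re_def g_def field_simps)
    ultimately show "schur n P0 i j = one_plus_re t (schur n G) i j - q i * cnj (q j)"
      unfolding q by (simp add: algebra_simps)
  qed
  also have "Re \<dots> \<le> Re (detn n (one_plus_re t (schur n G)))"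
    by (intro Re_detn_rank_one_le hermitian_one_plus_re accretive_one_plus_re G' t)
  finally show ?thesis
    using split t0 g unfolding P_def g_def by (simp add: mult_left_mono)
qed

text \<open>This is D(K). For accretive \<open>K\<close> and nonnegative \<open>t\<close> the
  determinant is already real and positive, and \<open>Re\<close> only makes it a real
  number.\<close>

definition det_re_inv :: "real \<Rightarrow> nat \<Rightarrow> (nat \<Rightarrow> nat \<Rightarrow> complex) \<Rightarrow> real" where
  "det_re_inv t n K = Re (detn n (one_plus_re t (inv_entry n K)))"

lemma det_re_inv_eq:
  assumes "accretive n K" "inverse_on n K G"
  shows "det_re_inv t n K = Re (detn n (one_plus_re t G))"
  unfolding det_re_inv_def
  using inverse_on_unique[OF accretive_inverse_on[OF assms(1)] assms(2)]
  by (intro arg_cong[where f = Re] detn_cong) (simp add: one_plus_re_def)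

lemma det_re_inv_pos:
  assumes K: "accretive n K" and t: "0 \<le> t"
  shows "0 < det_re_inv t n K"
  unfolding det_re_inv_def
  using posdef_detn[OF hermitian_one_plus_re
    accretive_one_plus_re[OF accretive_inverse[OF K accretive_inverse_on[OF K]] t]] by blast

text \<open>Block inversion used in both directions translates the inequality for the inverse into
  one for \<open>K\<close>: the leading block of the inverse belongs to the Schur complement of
  \<open>K\<close>, and the Schur complement of the inverse to the leading block of
  \<open>K\<close>.\<close>

lemma det_re_inv_step:
  assumes K: "accretive (Suc n) K" and t: "0 \<le> t"
  shows "det_re_inv t (Suc n) K \<le>
    det_re_inv t n (schur n K) + t * Re (inv_entry (Suc n) K n n) * det_re_inv t n K"
proof -
  let ?G = "inv_entry (Suc n) K"
  have inv: "inverse_on (Suc n) K ?G" by (rule accretive_inverse_on[OF K])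
  have G: "accretive (Suc n) ?G" by (rule accretive_inverse[OF K inv])
  have "inverse_on n (schur n K) ?G"
    by (rule inverse_on_schur[OF inv accretive_corner_nz[OF K]])
  then have 1: "det_re_inv t n (schur n K) = Re (detn n (one_plus_re t ?G))"
    by (rule det_re_inv_eq[OF accretive_schur[OF K]])
  have "inverse_on n K (schur n ?G)"
    by (rule inverse_on_sym[OF inverse_on_schur[OF inverse_on_sym[OF inv] accretive_corner_nz[OF G]]])
  then have 2: "det_re_inv t n K = Re (detn n (one_plus_re t (schur n ?G)))"
    by (rule det_re_inv_eq[OF accretive_minor[OF K]])
  show ?thesis
    unfolding 1 2 unfolding det_re_inv_def by (rule detn_one_plus_re_step[OF G t])
qed

section \<open>Averaging over the potential\<close>

lemma det_re_inv_cong: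
  assumes "\<And>i j. i < n \<Longrightarrow> j < n \<Longrightarrow> K i j = L i j"
  shows "det_re_inv t n K = det_re_inv t n L"
proof -
  have "Matrix.mat n n (\<lambda>(i, j). K i j) = Matrix.mat n n (\<lambda>(i, j). L i j)"
    by (auto intro!: eq_matI assms)
  then have "inv_entry n K = inv_entry n L"
    by (auto simp: inv_entry_def fun_eq_iff detn_def)
  then show ?thesis by (simp add: det_re_inv_def)
qed

section \<open>Measurability of determinants and inverses\<close>

lemma borel_measurable_detn:
  assumes [measurable]: "\<And>i j. i < n \<Longrightarrow> j < n \<Longrightarrow> (\<lambda>x. K x i j) \<in> borel_measurable M"
  shows "(\<lambda>x. detn n (K x)) \<in> borel_measurable M"
proof -
  have "detn n (K x) = (\<Sum>p\<in>{p. p permutes {0..<n}}. signof p * (\<Prod>i=0..<n. K x i (p i)))" for x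
    unfolding detn_def
    by (subst det_def'[of _ n])
       (auto intro!: sum.cong arg_cong2[where f = "(*)"] prod.cong dest: permutes_in_image)
  moreover have "(\<lambda>x. \<Sum>p\<in>{p. p permutes {0..<n}}. signof p * (\<Prod>i=0..<n. K x i (p i)))
      \<in> borel_measurable M"
  proof (intro borel_measurable_sum borel_measurable_times borel_measurable_const borel_measurable_prod)
    fix p i assume "p \<in> {p. p permutes {0..<n}}" "i \<in> {0..<n}"
    then have "i < n" "p i < n" using permutes_in_image[of p "{0..<n}" i] by auto
    then show "(\<lambda>x. K x i (p i)) \<in> borel_measurable M" by measurable
  qed
  ultimately show ?thesis by simp
qed

lemma borel_measurable_inv_entry:
  assumes K: "\<And>i j. i < n \<Longrightarrow> j < n \<Longrightarrow> (\<lambda>x. K x i j) \<in> borel_measurable M"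
    and ij: "i < n" "j < n"
  shows "(\<lambda>x. inv_entry n (K x) i j) \<in> borel_measurable M"
proof -
  \<comment> \<open>The cofactor sits at the transposed position, so the shifted indices skip row
    \<open>j\<close> and column \<open>i\<close>.\<close>
  have "inv_entry n (K x) i j = (- 1) ^ (j + i) *
      detn (n - 1) (\<lambda>a b. K x (if a < j then a else Suc a) (if b < i then b else Suc b)) / detn n (K x)" for x
  proof -
    have "mat_delete (Matrix.mat n n (\<lambda>(i, j). K x i j)) j i =
      Matrix.mat (n - 1) (n - 1) (\<lambda>(a, b). K x (if a < j then a else Suc a) (if b < i then b else Suc b))"
      unfolding mat_delete_def using ij by (auto intro!: eq_matI)
    then show ?thesis by (simp add: inv_entry_def Determinant.cofactor_def detn_def)
  qed
  moreover have "(\<lambda>x. (- 1) ^ (j + i) *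
      detn (n - 1) (\<lambda>a b. K x (if a < j then a else Suc a) (if b < i then b else Suc b)) / detn n (K x))
      \<in> borel_measurable M"
    by (intro borel_measurable_divide borel_measurable_times borel_measurable_const
        borel_measurable_detn) (auto intro: K)
  ultimately show ?thesis by simp
qed

lemma borel_measurable_det_re_inv:
  assumes "\<And>i j. i < n \<Longrightarrow> j < n \<Longrightarrow> (\<lambda>x. K x i j) \<in> borel_measurable M"
  shows "(\<lambda>x. det_re_inv t n (K x)) \<in> borel_measurable M"
proof -
  have "(\<lambda>x. detn n (one_plus_re t (inv_entry n (K x)))) \<in> borel_measurable M"
  proof (rule borel_measurable_detn)
    fix i j assume ij: "i < n" "j < n"
    have [measurable]: "(\<lambda>x. inv_entry n (K x) i j) \<in> borel_measurable M"
      by (rule borel_measurable_inv_entry[OF assms ij])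
    have "(\<lambda>x. inv_entry n (K x) j i) \<in> borel_measurable M"
      by (rule borel_measurable_inv_entry[OF assms ij(2,1)])
    then have [measurable]: "(\<lambda>x. cnj (inv_entry n (K x) j i)) \<in> borel_measurable M"
      by (rule measurable_compose) (intro borel_measurable_continuous_onI continuous_intros)
    show "(\<lambda>x. one_plus_re t (inv_entry n (K x)) i j) \<in> borel_measurable M"
      unfolding one_plus_re_def by measurable
  qed
  then show ?thesis unfolding det_re_inv_def by measurable
qed

section \<open>The Poisson kernel\<close>

lemma nn_integral_half_Poisson_kernel:
  fixes y :: real
  assumes y: "0 < y"
  shows "(\<integral>\<^sup>+x. ennreal (y / (y\<^sup>2 + x\<^sup>2)) * indicator {0..} x \<partial>lborel) = ennreal (pi / 2)"
proof -
  have pos: "0 < y\<^sup>2 + x\<^sup>2" for x using y by (simp add: add_pos_nonneg)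
  have "(\<integral>\<^sup>+x. ennreal (y / (y\<^sup>2 + x\<^sup>2)) * indicator {0..} x \<partial>lborel) =
      ennreal (pi / 2 - arctan (0 / y))"
  proof (rule nn_integral_FTC_atLeast)
    show "(\<lambda>x. y / (y\<^sup>2 + x\<^sup>2)) \<in> borel_measurable borel" by measurable
    show "((\<lambda>x. arctan (x / y)) has_real_derivative y / (y\<^sup>2 + x\<^sup>2)) (at x)" for x
      using y pos[of x]
      by (auto intro!: derivative_eq_intros simp: field_simps power2_eq_square add_nonneg_eq_0_iff)
    show "0 \<le> y / (y\<^sup>2 + x\<^sup>2)" for x using y by simp
    have "filterlim (\<lambda>x. x / y) at_top at_top"
      using filterlim_tendsto_pos_mult_at_top[OF tendsto_const[of "inverse y"] _ filterlim_ident] y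
      by (simp add: field_simps)
    then show "((\<lambda>x. arctan (x / y)) \<longlongrightarrow> pi / 2) at_top"
      by (rule filterlim_compose[OF tendsto_arctan_at_top])
  qed
  then show ?thesis by simp
qed

text \<open>Translating by Im \<kappa> gives the centred kernel, whose mass is twice that of a
  half-line by reflection.\<close>

lemma nn_integral_Poisson_kernel_le:
  fixes \<kappa> :: complex
  assumes \<kappa>: "0 < Re \<kappa>"
  shows "(\<integral>\<^sup>+x. ennreal (Re (1 / (\<kappa> + \<i> * of_real x))) \<partial>lborel) \<le> ennreal pi"
proof -
  define y where "y = Re \<kappa>"
  have y: "0 < y" using \<kappa> by (simp add: y_def)
  let ?h = "\<lambda>x::real. ennreal (y / (y\<^sup>2 + x\<^sup>2))"
  let ?f = "\<lambda>x::real. ennreal (Re (1 / (\<kappa> + \<i> * of_real x)))"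
  have [measurable]: "?f \<in> borel_measurable borel"
    by measurable
  have f: "?f (- Im \<kappa> + 1 * x) = ?h x" for x
    by (simp add: Re_divide y_def)
  have "(\<integral>\<^sup>+x. ?f x \<partial>lborel) = (\<integral>\<^sup>+x. ?h x \<partial>lborel)"
    by (subst nn_integral_real_affine[where c = 1 and t = "- Im \<kappa>"]) (auto simp only: f, simp_all)
  \<comment> \<open>The point 0 lies in both half-lines, whence an inequality rather than an
    equality of integrands.\<close>
  also have "\<dots> \<le> (\<integral>\<^sup>+x. ?h x * indicator {0..} x + ?h (- x) * indicator {0..} (- x) \<partial>lborel)"
    by (intro nn_integral_mono) (auto simp: indicator_def)
  also have "\<dots> = (\<integral>\<^sup>+x. ?h x * indicator {0..} x \<partial>lborel) +
      (\<integral>\<^sup>+x. ?h (- x) * indicator {0..} (- x) \<partial>lborel)"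
    by (rule nn_integral_add) measurable
  also have "(\<integral>\<^sup>+x. ?h (- x) * indicator {0..} (- x) \<partial>lborel) =
      (\<integral>\<^sup>+x. ?h x * indicator {0..} x \<partial>lborel)"
    using nn_integral_real_affine[of "\<lambda>x. ?h x * indicator {0..} x" "-1" 0] by simp
  also have "(\<integral>\<^sup>+x. ?h x * indicator {0..} x \<partial>lborel) + (\<integral>\<^sup>+x. ?h x * indicator {0..} x \<partial>lborel)
      = ennreal pi"
    using nn_integral_half_Poisson_kernel[OF y] by (simp flip: ennreal_plus)
  finally show ?thesis .
qed

section \<open>Dependence on the potential\<close>

text \<open>The potential enters i(H - z) as an imaginary diagonal, which leaves the Hermitian part
  unchanged.\<close>

definition diag_shift :: "(nat \<Rightarrow> nat \<Rightarrow> complex) \<Rightarrow> (nat \<Rightarrow> real) \<Rightarrow> nat \<Rightarrow> nat \<Rightarrow> complex" where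
  "diag_shift K v i j = K i j + (if i = j then \<i> * of_real (v i) else 0)"

lemma accretive_diag_shift:
  assumes "accretive n K"
  shows "accretive n (diag_shift K v)"
  unfolding accretive_def
proof (intro allI impI, elim exE conjE)
  fix \<xi> :: "nat \<Rightarrow> complex" and i assume i: "i < n" "\<xi> i \<noteq> 0"
  have "qform n (diag_shift K v) \<xi> = qform n K \<xi> +
      (\<Sum>i<n. \<Sum>j<n. if i = j then cnj (\<xi> i) * (\<i> * of_real (v i)) * \<xi> i else 0)"
    unfolding qform_def sum.distrib[symmetric]
    by (intro sum.cong refl) (simp add: diag_shift_def algebra_simps)
  also have "(\<Sum>i<n. \<Sum>j<n. if i = j then cnj (\<xi> i) * (\<i> * of_real (v i)) * \<xi> i else 0) =
      (\<Sum>i<n. cnj (\<xi> i) * (\<i> * of_real (v i)) * \<xi> i)"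
    by (intro sum.cong refl) simp
  finally have "Re (qform n (diag_shift K v) \<xi>) = Re (qform n K \<xi>)"
    by (simp add: algebra_simps)
  then show "0 < Re (qform n (diag_shift K v) \<xi>)"
    using accretiveD[OF assms, of i] i by simp
qed

text \<open>Viewed as a function of the last diagonal entry alone, the corner of the inverse is a
  Poisson kernel on the imaginary axis.\<close>

lemma inv_entry_corner_diag_shift:
  assumes K: "accretive (Suc n) K"
  obtains \<kappa> where "0 < Re \<kappa>"
    "\<And>x. inv_entry (Suc n) (diag_shift K (w(n := x))) n n = 1 / (\<kappa> + \<i> * of_real x)"
proof -
  \<comment> \<open>The leading block does not contain coordinate \<open>n\<close> of the potential,
    so \<open>R\<close> and hence \<kappa> are independent of x.\<close>
  define R where "R = inv_entry n (diag_shift K w)"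
  define \<kappa> where "\<kappa> = K n n - (\<Sum>i<n. \<Sum>j<n. K n i * R i j * K j n)"
  have Kx: "accretive (Suc n) (diag_shift K (w(n := x)))" for x
    by (rule accretive_diag_shift[OF K])
  have inv: "inverse_on (Suc n) (diag_shift K (w(n := x))) (inv_entry (Suc n) (diag_shift K (w(n := x))))" for x
    by (rule accretive_inverse_on[OF Kx])
  have R: "inverse_on n (diag_shift K (w(n := x))) R" for x
  proof -
    have "inverse_on n (diag_shift K w) R"
      unfolding R_def by (intro accretive_inverse_on accretive_diag_shift accretive_minor[OF K])
    moreover have "diag_shift K (w(n := x)) i j = diag_shift K w i j" if "i < n" "j < n" for i j
      using that by (simp add: diag_shift_def)
    ultimately show ?thesis by (simp add: inverse_on_def)
  qed
  have c: "inv_entry (Suc n) (diag_shift K (w(n := x))) n n * (\<kappa> + \<i> * of_real x) = 1" for x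
  proof -
    have "(\<Sum>i<n. \<Sum>j<n. diag_shift K (w(n := x)) n i * R i j * diag_shift K (w(n := x)) j n) =
        (\<Sum>i<n. \<Sum>j<n. K n i * R i j * K j n)"
      by (intro sum.cong refl) (auto simp: diag_shift_def)
    with inverse_on_corner[OF inv[of x] R[of x]] show ?thesis
      by (simp add: \<kappa>_def) (simp add: diag_shift_def algebra_simps)
  qed
  \<comment> \<open>At x = 0 the corner of the inverse is 1 / \<kappa>. It lies in the right
    half-plane, which inversion preserves.\<close>
  have "0 < Re (inv_entry (Suc n) (diag_shift K (w(n := 0))) n n)"
    by (rule accretive_corner[OF accretive_inverse[OF Kx inv]])
  moreover have "\<kappa> = inverse (inv_entry (Suc n) (diag_shift K (w(n := 0))) n n)"
    using c[of 0] by (intro inverse_unique[symmetric]) simp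
  ultimately have "0 < Re \<kappa>"
    by (simp add: add_pos_nonneg)
  moreover have "inv_entry (Suc n) (diag_shift K (w(n := x))) n n = 1 / (\<kappa> + \<i> * of_real x)" for x
    unfolding inverse_eq_divide[symmetric]
    using c[of x] by (intro inverse_unique[symmetric]) (simp add: mult.commute)
  ultimately show ?thesis using that by blast
qed

text \<open>With the last variable frozen at \<open>x\<close>, the others enter the Schur complement
  only as a diagonal shift of a fixed matrix, the form required by the induction below.\<close>

lemma schur_diag_shift:
  assumes "i < n" "j < n"
  shows "schur n (diag_shift K (w(n := x))) i j = diag_shift (schur n (diag_shift K (\<lambda>i. if i = n then x else 0))) w i j"
  using assms by (auto simp: schur_def diag_shift_def)

lemma borel_measurable_diag_shift:
  assumes M: "\<And>i. i \<in> I \<Longrightarrow> sets (M i) = sets borel" and i: "i \<in> I"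
  shows "(\<lambda>v. diag_shift K v i j) \<in> borel_measurable (Pi\<^sub>M I M)"
proof -
  have "(\<lambda>v. v i) \<in> measurable (Pi\<^sub>M I M) (M i)" by (rule measurable_component_singleton[OF i])
  then have "(\<lambda>v. v i) \<in> borel_measurable (Pi\<^sub>M I M)"
    by (subst measurable_cong_sets[OF refl M[OF i, symmetric]])
  then show ?thesis unfolding diag_shift_def by measurable
qed

text \<open>Induction with \<open>K\<close> arbitrary, since the recursion needs the bound both for
  a Schur complement and for a leading minor. The two terms contribute c and t \<pi> B c, where c is
  the bound for size n.\<close>

lemma nn_integral_det_re_inv_le:
  fixes \<rho> :: "real \<Rightarrow> real"
  assumes [measurable]: "\<rho> \<in> borel_measurable borel"
    and nonneg: "\<And>x. 0 \<le> \<rho> x" and bounded: "\<And>x. \<rho> x \<le> B"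
    and prob: "prob_space (density lborel (\<lambda>x. ennreal (\<rho> x)))"
    and t: "0 \<le> t"
    and K: "accretive n K"
  shows "(\<integral>\<^sup>+v. ennreal (det_re_inv t n (diag_shift K v)) \<partial>potential_law n \<rho>)
    \<le> ennreal ((1 + t * pi * B) ^ n)"
  using K
proof (induction n arbitrary: K)
  case 0
  have "det_re_inv t 0 L = 1" for L by (simp add: det_re_inv_def)
  then show ?case
    using prob_space.emeasure_space_1[OF prob_space_PiM[OF prob, of "{..<0::nat}"]]
    by (simp add: potential_law_def)
next
  case (Suc n)
  define D where "D = density lborel (\<lambda>x. ennreal (\<rho> x))"
  have D [simp, measurable_cong]: "sets D = sets borel" "space D = UNIV" by (auto simp: D_def)
  interpret D: prob_space D using prob by (simp add: D_def)
  interpret P: product_sigma_finite "\<lambda>_::nat. D" by standard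
  interpret PS: product_prob_space "\<lambda>_::nat. D" "{..<n}" by standard
  have law: "potential_law m \<rho> = Pi\<^sub>M {..<m} (\<lambda>_. D)" for m by (simp add: potential_law_def D_def)
  have B: "0 \<le> B" using nonneg[of 0] bounded[of 0] by linarith
  define c where "c = (1 + t * pi * B) ^ n"
  have c: "0 \<le> c" unfolding c_def using t B by (intro zero_le_power) (simp add: mult_nonneg_nonneg)
  let ?K = "\<lambda>v. diag_shift K v"
  have acc: "accretive (Suc n) (?K v)" for v by (rule accretive_diag_shift[OF Suc.prems])
  let ?f1 = "\<lambda>v. ennreal (det_re_inv t n (schur n (?K v)))"
  let ?f2 = "\<lambda>v. ennreal (t * Re (inv_entry (Suc n) (?K v) n n)) * ennreal (det_re_inv t n (?K v))"
  let ?PI = "Pi\<^sub>M (insert n {..<n}) (\<lambda>_. D)"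
  have Kmeas [measurable]: "(\<lambda>v. ?K v i j) \<in> borel_measurable ?PI" if "i < Suc n" for i j
    by (rule borel_measurable_diag_shift) (use that in auto)
  have [measurable]: "?f1 \<in> borel_measurable ?PI"
  proof -
    have "(\<lambda>v. det_re_inv t n (schur n (?K v))) \<in> borel_measurable ?PI"
      by (rule borel_measurable_det_re_inv) (simp add: schur_def)
    then show ?thesis by measurable
  qed
  have [measurable]: "?f2 \<in> borel_measurable ?PI"
  proof -
    have "(\<lambda>v. det_re_inv t n (?K v)) \<in> borel_measurable ?PI"
      by (rule borel_measurable_det_re_inv) simp
    moreover have "(\<lambda>v. inv_entry (Suc n) (?K v) n n) \<in> borel_measurable ?PI"
      by (rule borel_measurable_inv_entry) auto
    ultimately show ?thesis by measurable
  qed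
  have g0: "0 \<le> Re (inv_entry (Suc n) (?K v) n n)" for v
    using accretive_corner[OF accretive_inverse[OF acc accretive_inverse_on[OF acc]]] by (rule less_imp_le)
  have d0: "0 \<le> det_re_inv t n (?K v)" "0 \<le> det_re_inv t n (schur n (?K v))" for v
    using det_re_inv_pos[OF accretive_minor[OF acc] t] det_re_inv_pos[OF accretive_schur[OF acc] t]
    by (auto intro: less_imp_le)
  have "(\<integral>\<^sup>+v. ennreal (det_re_inv t (Suc n) (?K v)) \<partial>?PI) \<le> (\<integral>\<^sup>+v. ?f1 v + ?f2 v \<partial>?PI)"
  proof (rule nn_integral_mono)
    fix v
    have "ennreal (det_re_inv t (Suc n) (?K v)) \<le>
      ennreal (det_re_inv t n (schur n (?K v)) + t * Re (inv_entry (Suc n) (?K v) n n) * det_re_inv t n (?K v))"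
      by (rule ennreal_leI[OF det_re_inv_step[OF acc t]])
    also have "\<dots> = ?f1 v + ?f2 v"
      using d0 g0 t by (subst ennreal_plus) (auto simp: ennreal_mult)
    finally show "ennreal (det_re_inv t (Suc n) (?K v)) \<le> ?f1 v + ?f2 v" .
  qed
  also have "\<dots> = (\<integral>\<^sup>+v. ?f1 v \<partial>?PI) + (\<integral>\<^sup>+v. ?f2 v \<partial>?PI)"
    by (rule nn_integral_add) measurable
  also have "(\<integral>\<^sup>+v. ?f1 v \<partial>?PI) \<le> ennreal c"
  proof -
    \<comment> \<open>The last variable is integrated last: for each frozen value the induction
      hypothesis gives the same bound, and the outer measure has mass 1.\<close>
    have "(\<integral>\<^sup>+v. ?f1 v \<partial>?PI) = (\<integral>\<^sup>+x. (\<integral>\<^sup>+w. ?f1 (w(n := x)) \<partial>Pi\<^sub>M {..<n} (\<lambda>_. D)) \<partial>D)"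
      by (rule P.product_nn_integral_insert_rev) auto
    also have "\<dots> \<le> (\<integral>\<^sup>+x. ennreal c \<partial>D)"
    proof (rule nn_integral_mono)
      fix x
      let ?L = "schur n (?K (\<lambda>i. if i = n then x else 0))"
      have "?f1 (w(n := x)) = ennreal (det_re_inv t n (diag_shift ?L w))" for w
        by (intro arg_cong[where f = ennreal] det_re_inv_cong schur_diag_shift)
      then show "(\<integral>\<^sup>+w. ?f1 (w(n := x)) \<partial>Pi\<^sub>M {..<n} (\<lambda>_. D)) \<le> ennreal c"
        using Suc.IH[OF accretive_schur[OF acc], of "\<lambda>i. if i = n then x else 0"]
        by (simp add: law c_def)
    qed
    also have "\<dots> = ennreal c" by (simp add: D.emeasure_space_1[simplified])
    finally show ?thesis .
  qed
  also have "(\<integral>\<^sup>+v. ?f2 v \<partial>?PI) \<le> ennreal (t * pi * B * c)"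
  proof -
    \<comment> \<open>The opposite order: the last variable is integrated first, because the minor
      does not contain it and it occurs only in the Poisson kernel.\<close>
    have "(\<integral>\<^sup>+v. ?f2 v \<partial>?PI) = (\<integral>\<^sup>+w. (\<integral>\<^sup>+x. ?f2 (w(n := x)) \<partial>D) \<partial>Pi\<^sub>M {..<n} (\<lambda>_. D))"
      by (rule P.product_nn_integral_insert) auto
    also have "\<dots> \<le> (\<integral>\<^sup>+w. ennreal (t * pi * B) * ennreal (det_re_inv t n (?K w)) \<partial>Pi\<^sub>M {..<n} (\<lambda>_. D))"
    proof (rule nn_integral_mono)
      fix w
      obtain \<kappa> where \<kappa>: "0 < Re \<kappa>" "\<And>x. inv_entry (Suc n) (?K (w(n := x))) n n = 1 / (\<kappa> + \<i> * of_real x)"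
        using inv_entry_corner_diag_shift[OF Suc.prems] by blast
      have dw: "det_re_inv t n (?K (w(n := x))) = det_re_inv t n (?K w)" for x
        by (rule det_re_inv_cong) (auto simp: diag_shift_def)
      have P0: "0 \<le> Re (1 / (\<kappa> + \<i> * of_real x))" for x using g0[of "w(n := x)"] by (simp only: \<kappa>)
      have [measurable]: "(\<lambda>x. ennreal (Re (1 / (\<kappa> + \<i> * of_real x)))) \<in> borel_measurable borel"
        by measurable
      have "(\<integral>\<^sup>+x. ?f2 (w(n := x)) \<partial>D) =
        (\<integral>\<^sup>+x. (ennreal t * ennreal (det_re_inv t n (?K w))) * ennreal (Re (1 / (\<kappa> + \<i> * of_real x))) \<partial>D)"
        by (intro nn_integral_cong) (simp only: \<kappa> dw ennreal_mult[OF t P0] mult_ac)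
      also have "\<dots> = (ennreal t * ennreal (det_re_inv t n (?K w))) *
          (\<integral>\<^sup>+x. ennreal (Re (1 / (\<kappa> + \<i> * of_real x))) \<partial>D)"
        by (rule nn_integral_cmult) measurable
      also have "(\<integral>\<^sup>+x. ennreal (Re (1 / (\<kappa> + \<i> * of_real x))) \<partial>D) \<le> ennreal (B * pi)"
      proof -
        have "(\<integral>\<^sup>+x. ennreal (Re (1 / (\<kappa> + \<i> * of_real x))) \<partial>D) =
          (\<integral>\<^sup>+x. ennreal (\<rho> x) * ennreal (Re (1 / (\<kappa> + \<i> * of_real x))) \<partial>lborel)"
          unfolding D_def by (rule nn_integral_density) measurable
        also have "\<dots> \<le> (\<integral>\<^sup>+x. ennreal B * ennreal (Re (1 / (\<kappa> + \<i> * of_real x))) \<partial>lborel)"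
          by (intro nn_integral_mono mult_right_mono ennreal_leI bounded) auto
        also have "\<dots> = ennreal B * (\<integral>\<^sup>+x. ennreal (Re (1 / (\<kappa> + \<i> * of_real x))) \<partial>lborel)"
          by (rule nn_integral_cmult) measurable
        also have "\<dots> \<le> ennreal B * ennreal pi"
          by (intro mult_left_mono nn_integral_Poisson_kernel_le \<kappa>) simp
        finally show ?thesis using B by (simp add: ennreal_mult)
      qed
      also have "(ennreal t * ennreal (det_re_inv t n (?K w))) * ennreal (B * pi) =
          ennreal (t * pi * B) * ennreal (det_re_inv t n (?K w))"
        using t B d0[of w] by (simp add: mult_ac flip: ennreal_mult)
      finally show "(\<integral>\<^sup>+x. ?f2 (w(n := x)) \<partial>D) \<le> ennreal (t * pi * B) * ennreal (det_re_inv t n (?K w))"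
        by (simp add: mult_left_mono)
    qed
    also have "\<dots> = ennreal (t * pi * B) * (\<integral>\<^sup>+w. ennreal (det_re_inv t n (?K w)) \<partial>Pi\<^sub>M {..<n} (\<lambda>_. D))"
    proof (rule nn_integral_cmult)
      have "(\<lambda>v. det_re_inv t n (?K v)) \<in> borel_measurable (Pi\<^sub>M {..<n} (\<lambda>_. D))"
        by (intro borel_measurable_det_re_inv borel_measurable_diag_shift) auto
      then show "(\<lambda>v. ennreal (det_re_inv t n (?K v))) \<in> borel_measurable (Pi\<^sub>M {..<n} (\<lambda>_. D))"
        by measurable
    qed
    also have "\<dots> \<le> ennreal (t * pi * B) * ennreal c"
      using Suc.IH[OF accretive_minor[OF Suc.prems]] by (intro mult_left_mono) (auto simp: law c_def)
    finally show ?thesis using t B c by (simp add: ennreal_mult)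
  qed
  finally have "(\<integral>\<^sup>+v. ennreal (det_re_inv t (Suc n) (?K v)) \<partial>?PI) \<le> ennreal c + ennreal (t * pi * B * c)"
    by (simp add: add_mono)
  also have "\<dots> = ennreal ((1 + t * pi * B) ^ Suc n)"
    using c t B by (simp add: c_def algebra_simps flip: ennreal_plus)
  finally show ?case by (simp add: law lessThan_Suc)
qed

section \<open>Resolvents of Hermitian matrices\<close>

lemma hermitian_mat_carrier: "hermitian_mat N A \<Longrightarrow> A \<in> carrier_mat N N"
  by (simp add: hermitian_mat_def)

lemma hermitian_mat_cnj: "hermitian_mat N A \<Longrightarrow> i < N \<Longrightarrow> j < N \<Longrightarrow> cnj (A $$ (i, j)) = A $$ (j, i)"
  unfolding hermitian_mat_def by (metis complex_cnj_cnj)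

lemma qform_hermitian_mat_real:
  assumes "hermitian_mat N A"
  shows "Im (qform N (\<lambda>i j. A $$ (i, j)) \<xi>) = 0"
proof -
  have "cnj (qform N (\<lambda>i j. A $$ (i, j)) \<xi>) = (\<Sum>i<N. \<Sum>j<N. cnj (\<xi> j) * A $$ (j, i) * \<xi> i)"
    unfolding qform_def cnj_sum
    by (intro sum.cong refl) (simp add: hermitian_mat_cnj[OF assms] mult_ac)
  also have "\<dots> = qform N (\<lambda>i j. A $$ (i, j)) \<xi>"
    unfolding qform_def by (rule sum.swap)
  finally show ?thesis by (simp add: complex_eq_iff)
qed

text \<open>At an eigenvector the form is real and equals c times a positive number.\<close>

lemma hermitian_eigenvalue_real:
  assumes A: "hermitian_mat N A" and ev: "eigenvalue A c"
  shows "Im c = 0"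
proof -
  from ev obtain v where v: "v \<in> carrier_vec N" "v \<noteq> 0\<^sub>v N" "A *\<^sub>v v = c \<cdot>\<^sub>v v"
    using hermitian_mat_carrier[OF A] by (auto simp: eigenvalue_def eigenvector_def)
  have row: "(\<Sum>j<N. A $$ (i, j) * vec_index v j) = c * vec_index v i" if "i < N" for i
  proof -
    have "vec_index (A *\<^sub>v v) i = (\<Sum>j<N. A $$ (i, j) * vec_index v j)"
      using that v(1) hermitian_mat_carrier[OF A]
      by (simp add: scalar_prod_def atLeast0LessThan)
    then show ?thesis using that v by simp
  qed
  have "qform N (\<lambda>i j. A $$ (i, j)) (\<lambda>i. vec_index v i) = (\<Sum>i<N. cnj (vec_index v i) * (\<Sum>j<N. A $$ (i, j) * vec_index v j))"
    by (simp add: qform_def sum_distrib_left mult.assoc)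
  also have "\<dots> = (\<Sum>i<N. c * of_real ((cmod (vec_index v i))\<^sup>2))"
    unfolding complex_norm_square by (intro sum.cong refl) (simp add: row)
  also have "\<dots> = c * of_real (\<Sum>i<N. (cmod (vec_index v i))\<^sup>2)"
    by (simp add: sum_distrib_left)
  finally have "Im c * (\<Sum>i<N. (cmod (vec_index v i))\<^sup>2) = 0"
    using qform_hermitian_mat_real[OF A, of "\<lambda>i. vec_index v i"] by simp
  moreover have "(\<Sum>i<N. (cmod (vec_index v i))\<^sup>2) \<noteq> 0"
  proof
    assume "(\<Sum>i<N. (cmod (vec_index v i))\<^sup>2) = 0"
    then have "vec_index v i = 0" if "i < N" for i
      using that by (subst (asm) sum_nonneg_eq_0_iff) auto
    then have "v = 0\<^sub>v N" using v(1) by (intro eq_vecI) auto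
    then show False using v(2) by simp
  qed
  ultimately show ?thesis by simp
qed

section \<open>Triangular matrices, similarity and inverses\<close>

text \<open>In entry (i, j) of U T with j < i, the terms k > j vanish by triangularity of
  \<open>T\<close> and the terms k < j by induction on the column; what remains is U_{ij} T_{jj} =
  0.\<close>

lemma upper_triangular_left_inverse:
  fixes T U :: "'a::field mat"
  assumes T: "T \<in> carrier_mat n n" and U: "U \<in> carrier_mat n n" and UT: "U * T = 1\<^sub>m n"
    and tri: "upper_triangular T" and nz: "\<And>i. i < n \<Longrightarrow> T $$ (i, i) \<noteq> 0"
  shows "upper_triangular U" "\<And>i. i < n \<Longrightarrow> U $$ (i, i) = 1 / T $$ (i, i)"
proof -
  have eq: "(\<Sum>k<n. U $$ (i, k) * T $$ (k, j)) = (if i = j then 1 else 0)" if "i < n" "j < n" for i j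
  proof -
    have "(U * T) $$ (i, j) = (\<Sum>k<n. U $$ (i, k) * T $$ (k, j))"
      using that T U by (simp add: scalar_prod_def atLeast0LessThan)
    then show ?thesis using that by (simp add: UT)
  qed
  have T0: "T $$ (k, j) = 0" if "j < k" "k < n" for k j
    using tri that T by (auto simp: upper_triangular_def)
  have low: "U $$ (i, j) = 0" if "j < i" "i < n" for i j
    using that
  proof (induction j rule: less_induct)
    case (less j)
    have "(\<Sum>k<n. U $$ (i, k) * T $$ (k, j)) = (\<Sum>k<n. if k = j then U $$ (i, j) * T $$ (j, j) else 0)"
    proof (rule sum.cong[OF refl])
      fix k assume "k \<in> {..<n}"
      then show "U $$ (i, k) * T $$ (k, j) = (if k = j then U $$ (i, j) * T $$ (j, j) else 0)"
        using less.IH[of k] less.prems T0[of j k] by (cases k j rule: linorder_cases) auto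
    qed
    then show ?case using eq[of i j] less.prems nz[of j] by simp
  qed
  then show "upper_triangular U" using U by (auto simp: upper_triangular_def)
  show "U $$ (i, i) = 1 / T $$ (i, i)" if i: "i < n" for i
  proof -
    have "(\<Sum>k<n. U $$ (i, k) * T $$ (k, i)) = (\<Sum>k<n. if k = i then U $$ (i, i) * T $$ (i, i) else 0)"
    proof (rule sum.cong[OF refl])
      fix k assume "k \<in> {..<n}"
      then show "U $$ (i, k) * T $$ (k, i) = (if k = i then U $$ (i, i) * T $$ (i, i) else 0)"
        using i low[of k i] T0[of i k] by (cases k i rule: linorder_cases) auto
    qed
    then show ?thesis using eq[of i i] i nz[of i] by (simp add: field_simps)
  qed
qed

lemma mat_trace_similar:
  fixes P X Q :: "complex mat"
  assumes P: "P \<in> carrier_mat n n" and X: "X \<in> carrier_mat n n" and Q: "Q \<in> carrier_mat n n"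
    and QP: "Q * P = 1\<^sub>m n"
  shows "mat_trace (P * X * Q) = mat_trace X"
proof -
  have comm: "mat_trace (Y * Z) = mat_trace (Z * Y)"
    if "Y \<in> carrier_mat n n" "Z \<in> carrier_mat n n" for Y Z :: "complex mat"
  proof -
    have "mat_trace (Y * Z) = (\<Sum>i<n. \<Sum>k<n. Y $$ (i, k) * Z $$ (k, i))"
      using that by (simp add: mat_trace_def scalar_prod_def atLeast0LessThan)
    also have "\<dots> = (\<Sum>k<n. \<Sum>i<n. Z $$ (k, i) * Y $$ (i, k))"
      by (subst sum.swap) (simp add: mult.commute)
    also have "\<dots> = mat_trace (Z * Y)"
      using that by (simp add: mat_trace_def scalar_prod_def atLeast0LessThan)
    finally show ?thesis .
  qed
  have "mat_trace (P * X * Q) = mat_trace (Q * (P * X))"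
    by (rule comm) (use P X Q in auto)
  also have "Q * (P * X) = (Q * P) * X" using P X Q by (simp add: assoc_mult_mat[of Q n n P n X n])
  finally show ?thesis using X by (simp add: QP)
qed

lemma det_conjugate:
  fixes P X Q :: "complex mat"
  assumes P: "P \<in> carrier_mat n n" and X: "X \<in> carrier_mat n n" and Q: "Q \<in> carrier_mat n n"
    and QP: "Q * P = 1\<^sub>m n"
  shows "Determinant.det (P * X * Q) = Determinant.det X"
proof -
  have "Determinant.det Q * Determinant.det P = 1"
    using det_mult[OF Q P] by (simp add: QP)
  then show ?thesis
    using P X Q by (simp add: det_mult[of _ n]) (metis mult.assoc mult.commute mult_1)
qed

text \<open>A nonzero determinant excludes the value \<open>None\<close>, on which
  \<open>mat_inv\<close> would be unspecified.\<close>

lemma mat_inv_correct: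
  fixes M :: "complex mat"
  assumes M: "M \<in> carrier_mat n n" and det: "Determinant.det M \<noteq> 0"
  shows "M * mat_inv M = 1\<^sub>m n" "mat_inv M * M = 1\<^sub>m n" "mat_inv M \<in> carrier_mat n n"
proof -
  have "mat_inverse M \<noteq> None"
    using mat_inverse(1)[OF M, of "()"] det_non_zero_imp_unit[OF M det, of "()"] by blast
  then obtain R where R: "mat_inverse M = Some R" by blast
  then show "M * mat_inv M = 1\<^sub>m n" "mat_inv M * M = 1\<^sub>m n" "mat_inv M \<in> carrier_mat n n"
    using mat_inverse(2)[OF M R] by (auto simp: mat_inv_def)
qed

lemma inverse_on_of_mat:
  assumes M: "M \<in> carrier_mat n n" and R: "R \<in> carrier_mat n n"
    and MR: "M * R = 1\<^sub>m n" and RM: "R * M = 1\<^sub>m n"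
  shows "inverse_on n (\<lambda>i j. M $$ (i, j)) (\<lambda>i j. R $$ (i, j))"
proof -
  have entry: "(X * Y) $$ (i, j) = (\<Sum>k<n. X $$ (i, k) * Y $$ (k, j))"
    if "X \<in> carrier_mat n n" "Y \<in> carrier_mat n n" "i < n" "j < n" for X Y :: "complex mat" and i j
    using that by (simp add: scalar_prod_def atLeast0LessThan)
  have "(\<Sum>k<n. M $$ (i, k) * R $$ (k, j)) = (if i = j then 1 else 0)"
    "(\<Sum>k<n. R $$ (i, k) * M $$ (k, j)) = (if i = j then 1 else 0)" if "i < n" "j < n" for i j
    using entry[OF M R that] entry[OF R M that] that by (simp_all add: MR RM)
  then show ?thesis unfolding inverse_on_def by blast
qed

section \<open>Spectral representation of resolvents\<close>

definition resolvent :: "nat \<Rightarrow> complex mat \<Rightarrow> complex \<Rightarrow> complex mat" where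
  "resolvent N H z = mat_inv (H - z \<cdot>\<^sub>m 1\<^sub>m N)"

text \<open>Schur triangularization H = P B Q gives H - z = P (B - z) Q, and U z inverts B - z. The
  pair \<open>P\<close>, \<open>Q\<close> is the same for every z, so the resolvents at z and at its
  conjugate become triangular simultaneously.\<close>

lemma hermitian_triangularization:
  assumes H: "hermitian_mat N H"
  obtains es :: "real list" and P Q :: "complex mat" and U :: "complex \<Rightarrow> complex mat"
  where "length es = N" "P \<in> carrier_mat N N" "Q \<in> carrier_mat N N" "P * Q = 1\<^sub>m N" "Q * P = 1\<^sub>m N"
    "\<And>z. Im z \<noteq> 0 \<Longrightarrow> Determinant.det (H - z \<cdot>\<^sub>m 1\<^sub>m N) \<noteq> 0"
    "\<And>z. Im z \<noteq> 0 \<Longrightarrow> resolvent N H z = P * U z * Q"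
    "\<And>z. Im z \<noteq> 0 \<Longrightarrow> U z \<in> carrier_mat N N"
    "\<And>z. Im z \<noteq> 0 \<Longrightarrow> upper_triangular (U z)"
    "\<And>z i. Im z \<noteq> 0 \<Longrightarrow> i < N \<Longrightarrow> U z $$ (i, i) = 1 / (of_real (es ! i) - z)"
proof -
  have A: "H \<in> carrier_mat N N" by (rule hermitian_mat_carrier[OF H])
  obtain as where as: "char_poly H = (\<Prod>a\<leftarrow>as. [:- a, 1:])" "length as = N"
    using char_poly_factorized[OF A] by blast
  have real: "Im a = 0" if "a \<in> set as" for a
  proof (rule hermitian_eigenvalue_real[OF H])
    show "eigenvalue H a"
      using that unfolding eigenvalue_root_char_poly[OF A] as(1)
      by (simp add: poly_prod_list prod_list_zero_iff)
  qed
  obtain B P Q where BPQ: "schur_decomposition H as = (B, P, Q)"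
    by (cases "schur_decomposition H as")
  note sd = schur_decomposition[OF A as(1) BPQ]
  note sim = similar_mat_witD2[OF A conjunct1[OF sd]]
  have tri: "upper_triangular B" and diag: "diag_mat B = as" using sd by auto
  define es where "es = map Re as"
  have Bii: "B $$ (i, i) = of_real (es ! i)" if i: "i < N" for i
  proof -
    have "B $$ (i, i) = as ! i" using i sim(5) by (simp flip: diag add: diag_mat_def)
    then show ?thesis using i as(2) real[of "as ! i"] by (simp add: es_def complex_eq_iff)
  qed
  define T where "T z = B - z \<cdot>\<^sub>m 1\<^sub>m N" for z
  have T: "T z \<in> carrier_mat N N" "upper_triangular (T z)" for z
    using sim(5) tri by (auto simp: T_def upper_triangular_def)
  have Tii: "T z $$ (i, i) = of_real (es ! i) - z" if "i < N" for z i
    using that sim(5) by (simp add: T_def Bii)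
  have Tnz: "T z $$ (i, i) \<noteq> 0" if "Im z \<noteq> 0" "i < N" for z i
    using that by (auto simp: Tii complex_eq_iff)
  have HT: "H - z \<cdot>\<^sub>m 1\<^sub>m N = P * T z * Q" for z
  proof -
    have "P * T z * Q = (P * B - P * (z \<cdot>\<^sub>m 1\<^sub>m N)) * Q"
      unfolding T_def using sim by (subst mult_minus_distrib_mat) auto
    also have "\<dots> = P * B * Q - P * (z \<cdot>\<^sub>m 1\<^sub>m N) * Q"
      using sim by (subst minus_mult_distrib_mat) auto
    also have "P * (z \<cdot>\<^sub>m 1\<^sub>m N) = z \<cdot>\<^sub>m P"
      using sim(6) by (subst mult_smult_distrib[of _ N N]) auto
    also have "(z \<cdot>\<^sub>m P) * Q = z \<cdot>\<^sub>m 1\<^sub>m N"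
      using sim by (subst mult_smult_assoc_mat[of _ N N]) auto
    finally show ?thesis using sim(3) by simp
  qed
  have dT: "Determinant.det (T z) \<noteq> 0" if "Im z \<noteq> 0" for z
    using det_upper_triangular[OF T(2) T(1)] Tnz[OF that] T(1)[of z]
    by (auto simp: diag_mat_def prod_list_zero_iff)
  have dH: "Determinant.det (H - z \<cdot>\<^sub>m 1\<^sub>m N) \<noteq> 0" if "Im z \<noteq> 0" for z
    unfolding HT using det_conjugate[OF sim(6) T(1) sim(7) sim(2)] dT[OF that] by simp
  define U where "U z = mat_inv (T z)" for z
  have U: "T z * U z = 1\<^sub>m N" "U z * T z = 1\<^sub>m N" "U z \<in> carrier_mat N N" if "Im z \<noteq> 0" for z
    unfolding U_def using mat_inv_correct[OF T(1) dT[OF that]] by auto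
  have res: "resolvent N H z = P * U z * Q" if z: "Im z \<noteq> 0" for z
  proof -
    let ?M = "H - z \<cdot>\<^sub>m 1\<^sub>m N" and ?R = "resolvent N H z"
    have M: "?M \<in> carrier_mat N N" by (intro minus_carrier_mat smult_carrier_mat one_carrier_mat)
    note R = mat_inv_correct[OF M dH[OF z], folded resolvent_def]
    note C = sim(6) sim(7) T(1)[of z] U(3)[OF z] R(3) M
    have "?M * (P * U z * Q) = P * T z * (Q * P) * U z * Q"
      unfolding HT using C by (simp add: assoc_mult_mat[of _ N N _ N _ N] del: sim)
    also have "\<dots> = P * (T z * U z) * Q"
      using C by (simp add: sim(2) assoc_mult_mat[of _ N N _ N _ N])
    also have "\<dots> = 1\<^sub>m N"
      using C by (simp add: U(1)[OF z] sim(1))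
    finally have MX: "?M * (P * U z * Q) = 1\<^sub>m N" .
    have "?R = ?R * (?M * (P * U z * Q))" unfolding MX using C by simp
    also have "\<dots> = ?R * ?M * (P * U z * Q)" using C by (simp add: assoc_mult_mat[of _ N N _ N _ N])
    also have "\<dots> = P * U z * Q" using C by (simp add: R(2))
    finally show ?thesis .
  qed
  show ?thesis
  proof (rule that)
    show "length es = N" by (simp add: es_def as(2))
    show "upper_triangular (U z)" if "Im z \<noteq> 0" for z
      by (rule upper_triangular_left_inverse(1)[OF T(1) U(3) U(2) T(2) Tnz]) (use that in auto)
    show "U z $$ (i, i) = 1 / (of_real (es ! i) - z)" if "Im z \<noteq> 0" "i < N" for z i
      unfolding Tii[OF that(2), symmetric]
      by (rule upper_triangular_left_inverse(2)[OF T(1) U(3) U(2) T(2) Tnz]) (use that in auto)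
  qed (use sim dH res U in auto)
qed

lemma resolvent_correct:
  assumes H: "hermitian_mat N H" and z: "Im z \<noteq> 0"
  shows "(H - z \<cdot>\<^sub>m 1\<^sub>m N) * resolvent N H z = 1\<^sub>m N" "resolvent N H z * (H - z \<cdot>\<^sub>m 1\<^sub>m N) = 1\<^sub>m N"
    "resolvent N H z \<in> carrier_mat N N"
proof -
  have "Determinant.det (H - z \<cdot>\<^sub>m 1\<^sub>m N) \<noteq> 0"
    using hermitian_triangularization[OF H] z by metis
  moreover have "H - z \<cdot>\<^sub>m 1\<^sub>m N \<in> carrier_mat N N"
    by (intro minus_carrier_mat smult_carrier_mat one_carrier_mat)
  ultimately show
    "(H - z \<cdot>\<^sub>m 1\<^sub>m N) * resolvent N H z = 1\<^sub>m N" "resolvent N H z * (H - z \<cdot>\<^sub>m 1\<^sub>m N) = 1\<^sub>m N"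
    "resolvent N H z \<in> carrier_mat N N"
    unfolding resolvent_def by (auto intro: mat_inv_correct)
qed

text \<open>The adjoint of the resolvent at z inverts H - \<open>cnj z\<close>, and inverses are
  unique.\<close>

lemma resolvent_adjoint:
  assumes H: "hermitian_mat N H" and z: "Im z \<noteq> 0" and ij: "i < N" "j < N"
  shows "cnj (resolvent N H z $$ (j, i)) = resolvent N H (cnj z) $$ (i, j)"
proof -
  have z': "Im (cnj z) \<noteq> 0" using z by simp
  have C: "H - w \<cdot>\<^sub>m 1\<^sub>m N \<in> carrier_mat N N" for w
    by (intro minus_carrier_mat smult_carrier_mat one_carrier_mat)
  let ?M = "\<lambda>w i j. (H - w \<cdot>\<^sub>m 1\<^sub>m N) $$ (i, j)" and ?R = "\<lambda>w i j. resolvent N H w $$ (i, j)"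
  have inv: "inverse_on N (?M w) (?R w)" if "Im w \<noteq> 0" for w
    using resolvent_correct[OF H that] by (intro inverse_on_of_mat C) auto
  have adj: "cnj (?M z j i) = ?M (cnj z) i j" if "i < N" "j < N" for i j
    using that hermitian_mat_carrier[OF H] hermitian_mat_cnj[OF H, of j i] by auto
  have e: "(\<Sum>k<N. ?M (cnj z) i k * cnj (?R z j k)) = (if i = j then 1 else 0)"
    "(\<Sum>k<N. cnj (?R z k i) * ?M (cnj z) k j) = (if i = j then 1 else 0)" if "i < N" "j < N" for i j
  proof -
    have "(\<Sum>k<N. ?M (cnj z) i k * cnj (?R z j k)) = (\<Sum>k<N. cnj (?R z j k * ?M z k i))"
      by (intro sum.cong refl) (use adj that in \<open>simp add: mult.commute\<close>)
    also have "\<dots> = cnj (\<Sum>k<N. ?R z j k * ?M z k i)" by (simp only: cnj_sum)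
    finally show "(\<Sum>k<N. ?M (cnj z) i k * cnj (?R z j k)) = (if i = j then 1 else 0)"
      using inverse_onD[OF inverse_on_sym[OF inv[OF z]] that(2) that(1)] by auto
    have "(\<Sum>k<N. cnj (?R z k i) * ?M (cnj z) k j) = (\<Sum>k<N. cnj (?M z j k * ?R z k i))"
      by (intro sum.cong refl) (use adj that in \<open>simp add: mult.commute\<close>)
    also have "\<dots> = cnj (\<Sum>k<N. ?M z j k * ?R z k i)" by (simp only: cnj_sum)
    finally show "(\<Sum>k<N. cnj (?R z k i) * ?M (cnj z) k j) = (if i = j then 1 else 0)"
      using inverse_onD[OF inv[OF z] that(2) that(1)] by auto
  qed
  have "inverse_on N (?M (cnj z)) (\<lambda>i j. cnj (?R z j i))"
    unfolding inverse_on_def using e by blast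
  from inverse_on_unique[OF this inv[OF z'] ij] show ?thesis .
qed

text \<open>Trace and determinant are similarity invariants, and for triangular matrices both are
  read off the diagonal. This applies to the Hermitian part as well, which combines two
  simultaneously triangular resolvents.\<close>

lemma resolvent_spectral:
  assumes H: "hermitian_mat N H"
  obtains es :: "real list" where "length es = N"
    "\<And>z. Im z \<noteq> 0 \<Longrightarrow> mat_trace (resolvent N H z) = (\<Sum>i<N. 1 / (of_real (es ! i) - z))"
    "\<And>z t. Im z \<noteq> 0 \<Longrightarrow> detn N (one_plus_re t (\<lambda>i j. - \<i> * resolvent N H z $$ (i, j))) =
       of_real (\<Prod>i<N. 1 + t * Im (1 / (of_real (es ! i) - z)))"
proof -
  obtain es :: "real list" and P Q :: "complex mat" and U :: "complex \<Rightarrow> complex mat"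
    where es: "length es = N" and P: "P \<in> carrier_mat N N" and Q: "Q \<in> carrier_mat N N"
      and PQ: "P * Q = 1\<^sub>m N" and QP: "Q * P = 1\<^sub>m N"
      and res: "\<And>z. Im z \<noteq> 0 \<Longrightarrow> resolvent N H z = P * U z * Q"
      and U: "\<And>z. Im z \<noteq> 0 \<Longrightarrow> U z \<in> carrier_mat N N"
      and tri: "\<And>z. Im z \<noteq> 0 \<Longrightarrow> upper_triangular (U z)"
      and Uii: "\<And>z i. Im z \<noteq> 0 \<Longrightarrow> i < N \<Longrightarrow> U z $$ (i, i) = 1 / (of_real (es ! i) - z)"
    by (rule hermitian_triangularization[OF H]) blast
  show ?thesis
  proof (rule that[OF es])
    fix z assume z: "Im z \<noteq> 0"
    show "mat_trace (resolvent N H z) = (\<Sum>i<N. 1 / (of_real (es ! i) - z))"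
      using U[OF z] Uii[OF z] by (simp add: res[OF z] mat_trace_similar[OF P _ Q QP]) (simp add: mat_trace_def)
  next
    fix z t assume z: "Im z \<noteq> 0"
    then have z': "Im (cnj z) \<noteq> 0" by simp
    \<comment> \<open>Chosen so that, by \<open>resolvent_adjoint\<close>, a R(z) - a
      R(\<open>cnj z\<close>) is t times the Hermitian part of -i R(z).\<close>
    define a where "a = - \<i> * of_real t / 2"
    define X where "X = 1\<^sub>m N + (a \<cdot>\<^sub>m U z + (- a) \<cdot>\<^sub>m U (cnj z))"
    have X: "X \<in> carrier_mat N N" using U[OF z] U[OF z'] by (simp add: X_def)
    have PXQ: "P * X * Q = 1\<^sub>m N + (a \<cdot>\<^sub>m resolvent N H z + (- a) \<cdot>\<^sub>m resolvent N H (cnj z))"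
    proof -
      have D: "P * (Y + Z) * Q = P * Y * Q + P * Z * Q"
        if "Y \<in> carrier_mat N N" "Z \<in> carrier_mat N N" for Y Z
        unfolding mult_add_distrib_mat[OF P that]
        by (rule add_mult_distrib_mat[OF mult_carrier_mat[OF P that(1)] mult_carrier_mat[OF P that(2)] Q])
      have S: "P * (c \<cdot>\<^sub>m Y) * Q = c \<cdot>\<^sub>m (P * Y * Q)" if "Y \<in> carrier_mat N N" for Y c
        unfolding mult_smult_distrib[OF P that]
        by (rule mult_smult_assoc_mat[OF mult_carrier_mat[OF P that] Q])
      show ?thesis
        unfolding X_def using U[OF z] U[OF z'] P
        by (simp add: D S res[OF z] res[OF z'] PQ)
    qed
    have "Matrix.mat N N (\<lambda>(i, j). one_plus_re t (\<lambda>i j. - \<i> * resolvent N H z $$ (i, j)) i j) = P * X * Q"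
      unfolding PXQ
      using resolvent_correct(3)[OF H z] resolvent_correct(3)[OF H z'] resolvent_adjoint[OF H z]
      by (intro eq_matI) (auto simp: one_plus_re_def a_def field_simps)
    then have "detn N (one_plus_re t (\<lambda>i j. - \<i> * resolvent N H z $$ (i, j))) = Determinant.det X"
      by (simp add: detn_def det_conjugate[OF P X Q QP])
    also have "\<dots> = prod_list (diag_mat X)"
    proof (rule det_upper_triangular[OF _ X])
      show "upper_triangular X"
        using tri[OF z] tri[OF z'] U[OF z] U[OF z'] by (auto simp: upper_triangular_def X_def)
    qed
    also have "\<dots> = (\<Prod>i<N. X $$ (i, i))"
      using X by (simp add: diag_mat_def prod.list_conv_set_nth atLeast0LessThan)
    also have "\<dots> = (\<Prod>i<N. of_real (1 + t * Im (1 / (of_real (es ! i) - z))))"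
    proof (rule prod.cong[OF refl])
      fix i assume "i \<in> {..<N}"
      then have i: "i < N" by simp
      define u where "u = 1 / (of_real (es ! i) - z)"
      have "1 / (of_real (es ! i) - cnj z) = cnj u" by (simp add: u_def)
      then have "X $$ (i, i) = 1 + a * (u - cnj u)"
        using i U[OF z] U[OF z'] by (simp add: X_def Uii[OF z i] Uii[OF z' i] u_def[symmetric] algebra_simps)
      also have "\<dots> = of_real (1 + t * Im u)"
        by (simp add: a_def complex_eq_iff)
      finally show "X $$ (i, i) = of_real (1 + t * Im (1 / (of_real (es ! i) - z)))"
        by (simp add: u_def)
    qed
    finally show "detn N (one_plus_re t (\<lambda>i j. - \<i> * resolvent N H z $$ (i, j))) =
       of_real (\<Prod>i<N. 1 + t * Im (1 / (of_real (es ! i) - z)))"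
      by simp
  qed
qed

section \<open>The Stieltjes transform\<close>

lemma hermitian_add_diag:
  assumes "hermitian_mat N A"
  shows "hermitian_mat N (A + mat_diag N (\<lambda>i. complex_of_real (v i)))"
proof -
  have "(A + mat_diag N (\<lambda>i. complex_of_real (v i))) $$ (i, j) =
      cnj ((A + mat_diag N (\<lambda>i. complex_of_real (v i))) $$ (j, i))" if "i < N" "j < N" for i j
    using that hermitian_mat_cnj[OF assms, of j i] hermitian_mat_carrier[OF assms]
    by (auto simp: mat_diag_def)
  moreover have "A + mat_diag N (\<lambda>i. complex_of_real (v i)) \<in> carrier_mat N N"
    using hermitian_mat_carrier[OF assms] by simp
  ultimately show ?thesis unfolding hermitian_mat_def by blast
qed

lemma stieltjes_resolvent:
  "stieltjes N A v z =
     mat_trace (resolvent N (A + mat_diag N (\<lambda>i. complex_of_real (v i))) z) / of_nat N"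
  by (simp add: stieltjes_def resolvent_def)

section \<open>The matrix i(H - z)\<close>

text \<open>A diagonal shift by the potential turns this matrix i(A - z) into i(H - z). For
  Hermitian \<open>A\<close> its Hermitian part is Im z times the identity.\<close>

definition rotated_shift :: "complex mat \<Rightarrow> complex \<Rightarrow> nat \<Rightarrow> nat \<Rightarrow> complex" where
  "rotated_shift A z i j = \<i> * (A $$ (i, j) - (if i = j then z else 0))"

lemma accretive_rotated_shift:
  assumes A: "hermitian_mat N A" and z: "0 < Im z"
  shows "accretive N (rotated_shift A z)"
  unfolding accretive_def
proof (intro allI impI, elim exE conjE)
  fix \<xi> :: "nat \<Rightarrow> complex" and i assume i: "i < N" "\<xi> i \<noteq> 0"
  have "qform N (rotated_shift A z) \<xi> = \<i> * qform N (\<lambda>i j. A $$ (i, j)) \<xi> -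
      (\<Sum>i<N. \<Sum>j<N. if i = j then \<i> * z * of_real ((cmod (\<xi> i))\<^sup>2) else 0)"
    unfolding qform_def sum_distrib_left sum_subtractf[symmetric] complex_norm_square
    by (intro sum.cong refl) (simp add: rotated_shift_def algebra_simps)
  also have "(\<Sum>i<N. \<Sum>j<N. if i = j then \<i> * z * of_real ((cmod (\<xi> i))\<^sup>2) else 0) =
      (\<Sum>i<N. \<i> * z * of_real ((cmod (\<xi> i))\<^sup>2))"
    by (intro sum.cong refl) simp
  also have "\<dots> = \<i> * z * of_real (\<Sum>i<N. (cmod (\<xi> i))\<^sup>2)"
    by (simp add: sum_distrib_left)
  finally have "Re (qform N (rotated_shift A z) \<xi>) = Im z * (\<Sum>i<N. (cmod (\<xi> i))\<^sup>2)"
    using qform_hermitian_mat_real[OF A] by simp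
  moreover have "0 < (\<Sum>i<N. (cmod (\<xi> i))\<^sup>2)"
    by (rule sum_pos2[of _ i]) (use i in auto)
  ultimately show "0 < Re (qform N (rotated_shift A z) \<xi>)" using z by simp
qed

text \<open>The inverse of i(H - z) is -i times the resolvent.\<close>

lemma det_re_inv_rotated_shift:
  fixes v :: "nat \<Rightarrow> real"
  assumes A: "hermitian_mat N A" and z: "0 < Im z"
  defines "H \<equiv> A + mat_diag N (\<lambda>i. complex_of_real (v i))"
  shows "det_re_inv t N (diag_shift (rotated_shift A z) v) =
    Re (detn N (one_plus_re t (\<lambda>i j. - \<i> * resolvent N H z $$ (i, j))))"
proof (rule det_re_inv_eq)
  show "accretive N (diag_shift (rotated_shift A z) v)"
    by (intro accretive_diag_shift accretive_rotated_shift A z)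
  have H: "hermitian_mat N H" unfolding H_def by (rule hermitian_add_diag[OF A])
  have z0: "Im z \<noteq> 0" using z by simp
  define M where "M i j = (H - z \<cdot>\<^sub>m 1\<^sub>m N) $$ (i, j)" for i j
  define R where "R i j = resolvent N H z $$ (i, j)" for i j
  have inv: "inverse_on N M R"
    unfolding M_def R_def using resolvent_correct[OF H z0]
    by (intro inverse_on_of_mat minus_carrier_mat smult_carrier_mat one_carrier_mat) auto
  have D: "diag_shift (rotated_shift A z) v i j = \<i> * M i j" if "i < N" "j < N" for i j
    using that hermitian_mat_carrier[OF A]
    by (auto simp: M_def diag_shift_def rotated_shift_def H_def mat_diag_def algebra_simps)
  have "(\<Sum>k<N. diag_shift (rotated_shift A z) v i k * (- \<i> * R k j)) = (\<Sum>k<N. M i k * R k j)"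
    "(\<Sum>k<N. - \<i> * R i k * diag_shift (rotated_shift A z) v k j) = (\<Sum>k<N. R i k * M k j)"
    if "i < N" "j < N" for i j
    by (auto intro!: sum.cong simp: D that complex_eq_iff)
  then show "inverse_on N (diag_shift (rotated_shift A z) v) (\<lambda>i j. - \<i> * resolvent N H z $$ (i, j))"
    using inv unfolding inverse_on_def R_def[symmetric] by metis
qed

section \<open>Deterministic estimates from the eigenvalues\<close>

lemma exp_le_chord:
  fixes x :: real
  assumes "0 \<le> x" "x \<le> 1"
  shows "exp x \<le> 1 + (exp 1 - 1) * x"
  using convex_onD[OF exp_convex, of x 0 1] assms by (simp add: algebra_simps)

lemma Im_inverse_diff:
  "Im (1 / (complex_of_real e - z)) = Im z / ((e - Re z)\<^sup>2 + (Im z)\<^sup>2)"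
  by (simp add: Im_divide)

text \<open>The product in question is \<eta>^2 / ((e - E)^2 + \<eta>^2), a number in the interval
  where \<open>exp_le_chord\<close> applies.\<close>

lemma Im_inverse_diff_bounds:
  assumes "0 < Im z"
  shows "0 \<le> Im (1 / (complex_of_real e - z))" "Im z * Im (1 / (complex_of_real e - z)) \<le> 1"
proof -
  have "0 < (e - Re z)\<^sup>2 + (Im z)\<^sup>2" using assms by (simp add: add_nonneg_pos)
  then show "0 \<le> Im (1 / (complex_of_real e - z))" "Im z * Im (1 / (complex_of_real e - z)) \<le> 1"
    using assms unfolding Im_inverse_diff by (simp_all add: power2_eq_square)
qed

text \<open>Both sides factor over the eigenvalues: the exponent is the sum of the numbers Im z
  \<open>u i\<close> in [0, 1], and the product of their chords is the determinant.\<close>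

lemma exp_Im_stieltjes_le:
  assumes A: "hermitian_mat N A" and N: "0 < N" and z: "0 < Im z"
  shows "exp (real N * Im z * Im (stieltjes N A v z))
    \<le> det_re_inv ((exp 1 - 1) * Im z) N (diag_shift (rotated_shift A z) v)"
proof -
  define H where "H = A + mat_diag N (\<lambda>i. complex_of_real (v i))"
  have H: "hermitian_mat N H" unfolding H_def by (rule hermitian_add_diag[OF A])
  have z0: "Im z \<noteq> 0" using z by simp
  obtain es :: "real list" where
    tr: "mat_trace (resolvent N H z) = (\<Sum>i<N. 1 / (of_real (es ! i) - z))" and
    det: "\<And>t. detn N (one_plus_re t (\<lambda>i j. - \<i> * resolvent N H z $$ (i, j))) =
       of_real (\<Prod>i<N. 1 + t * Im (1 / (of_real (es ! i) - z)))"
    using resolvent_spectral[OF H] z0 by metis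
  define u where "u i = Im (1 / (complex_of_real (es ! i) - z))" for i
  have "real N * Im z * Im (stieltjes N A v z) = (\<Sum>i<N. Im z * u i)"
    using N unfolding stieltjes_resolvent H_def[symmetric] tr u_def
    by (simp only: Im_divide_of_nat Im_sum sum_distrib_left[symmetric]) simp
  then have "exp (real N * Im z * Im (stieltjes N A v z)) = (\<Prod>i<N. exp (Im z * u i))"
    by (simp add: exp_sum)
  also have "\<dots> \<le> (\<Prod>i<N. 1 + (exp 1 - 1) * (Im z * u i))"
    using z Im_inverse_diff_bounds[OF z] unfolding u_def
    by (intro prod_mono conjI exp_le_chord) auto
  also have "\<dots> = det_re_inv ((exp 1 - 1) * Im z) N (diag_shift (rotated_shift A z) v)"
    unfolding det_re_inv_rotated_shift[OF A z] H_def[symmetric] det u_def Re_complex_of_real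
    by (simp only: mult.assoc)
  finally show ?thesis .
qed

lemma cmod_stieltjes_le:
  assumes A: "hermitian_mat N A" and N: "0 < N" and z: "0 < Im z"
  shows "cmod (stieltjes N A v z) \<le> 1 / Im z"
proof -
  define H where "H = A + mat_diag N (\<lambda>i. complex_of_real (v i))"
  have H: "hermitian_mat N H" unfolding H_def by (rule hermitian_add_diag[OF A])
  have z0: "Im z \<noteq> 0" using z by simp
  obtain es :: "real list" where
    tr: "mat_trace (resolvent N H z) = (\<Sum>i<N. 1 / (of_real (es ! i) - z))"
    using resolvent_spectral[OF H] z0 by metis
  have "cmod (1 / (of_real e - z)) \<le> 1 / Im z" for e
    using abs_Im_le_cmod[of "of_real e - z"] z by (simp add: norm_divide frac_le)
  then have "cmod (\<Sum>i<N. 1 / (of_real (es ! i) - z)) \<le> (\<Sum>i<N. 1 / Im z)"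
    by (intro order_trans[OF norm_sum] sum_mono)
  then show ?thesis
    using N unfolding stieltjes_resolvent H_def[symmetric] tr by (simp add: norm_divide field_simps)
qed

text \<open>With z and w at heights \<eta> and 2 \<eta>, each eigenvalue e contributes \<eta> / (|e
  - z| |e - w|). Since |e - w| is at least |e - z|, this is at most \<eta> / |e - z|^2 = Im (1 / (e
  - z)).\<close>

lemma cmod_stieltjes_diff_le:
  assumes A: "hermitian_mat N A" and \<eta>: "0 < \<eta>"
  shows "cmod (stieltjes N A v (Complex E \<eta>) - stieltjes N A v (Complex E (2 * \<eta>)))
    \<le> Im (stieltjes N A v (Complex E \<eta>))"
proof -
  define H where "H = A + mat_diag N (\<lambda>i. complex_of_real (v i))"
  have H: "hermitian_mat N H" unfolding H_def by (rule hermitian_add_diag[OF A])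
  let ?z = "Complex E \<eta>" and ?w = "Complex E (2 * \<eta>)"
  obtain es :: "real list" where
    tr: "\<And>z. Im z \<noteq> 0 \<Longrightarrow> mat_trace (resolvent N H z) = (\<Sum>i<N. 1 / (of_real (es ! i) - z))"
    using resolvent_spectral[OF H] by metis
  have summand: "cmod (1 / (of_real e - ?z) - 1 / (of_real e - ?w)) \<le> Im (1 / (of_real e - ?z))" for e
  proof -
    have nz: "of_real e - ?z \<noteq> 0" "of_real e - ?w \<noteq> 0" using \<eta> by (auto simp: complex_eq_iff)
    have le: "cmod (of_real e - ?z) \<le> cmod (of_real e - ?w)"
      using \<eta> by (simp add: cmod_def power2_eq_square)
    have "1 / (of_real e - ?z) - 1 / (of_real e - ?w) = (?z - ?w) / ((of_real e - ?z) * (of_real e - ?w))"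
      using nz by (simp add: diff_frac_eq)
    then have "cmod (1 / (of_real e - ?z) - 1 / (of_real e - ?w)) =
        \<eta> / (cmod (of_real e - ?z) * cmod (of_real e - ?w))"
      using \<eta> by (simp add: norm_divide norm_mult) (simp add: cmod_def)
    also have "\<dots> \<le> \<eta> / (cmod (of_real e - ?z) * cmod (of_real e - ?z))"
      using \<eta> nz le by (intro divide_left_mono mult_left_mono mult_pos_pos) auto
    also have "\<dots> = Im (1 / (of_real e - ?z))"
      unfolding Im_inverse_diff by (simp add: cmod_def flip: power2_eq_square)
    finally show ?thesis .
  qed
  have "stieltjes N A v ?z - stieltjes N A v ?w =
      (\<Sum>i<N. 1 / (of_real (es ! i) - ?z) - 1 / (of_real (es ! i) - ?w)) / of_nat N"
    using \<eta> unfolding stieltjes_resolvent H_def[symmetric]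
    by (simp add: tr sum_subtractf diff_divide_distrib)
  then have "cmod (stieltjes N A v ?z - stieltjes N A v ?w) =
      cmod (\<Sum>i<N. 1 / (of_real (es ! i) - ?z) - 1 / (of_real (es ! i) - ?w)) / real N"
    by (simp add: norm_divide)
  also have "\<dots> \<le> (\<Sum>i<N. Im (1 / (of_real (es ! i) - ?z))) / real N"
    by (intro divide_right_mono order_trans[OF norm_sum] sum_mono summand) auto
  also have "\<dots> = Im (stieltjes N A v ?z)"
    using \<eta> unfolding stieltjes_resolvent H_def[symmetric]
    by (simp add: tr Im_divide_of_nat)
  finally show ?thesis .
qed

text \<open>Each of the \<open>K\<close> doublings of the height costs at most \<open>a\<close>; at
  the last height the trivial bound 1 / Im z takes over.\<close>

lemma cmod_stieltjes_dyadic: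
  assumes A: "hermitian_mat N A" and N: "0 < N" and \<eta>: "0 < \<eta>"
    and le: "\<And>k. k < K \<Longrightarrow> Im (stieltjes N A v (Complex E (2 ^ k * \<eta>))) \<le> a"
  shows "cmod (stieltjes N A v (Complex E \<eta>)) \<le> real K * a + 1 / (2 ^ K * \<eta>)"
proof -
  let ?S = "\<lambda>k. stieltjes N A v (Complex E (2 ^ k * \<eta>))"
  have "cmod (?S 0) \<le> real m * a + cmod (?S m)" if "m \<le> K" for m
    using that
  proof (induction m)
    case (Suc m)
    have "cmod (?S m) \<le> cmod (?S m - ?S (Suc m)) + cmod (?S (Suc m))"
      by (metis add.commute norm_triangle_sub)
    also have "cmod (?S m - ?S (Suc m)) \<le> a"
      using cmod_stieltjes_diff_le[OF A, of "2 ^ m * \<eta>" v E] le[of m] Suc.prems \<eta>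
      by (simp add: mult.assoc)
    finally show ?case using Suc by (simp add: algebra_simps)
  qed simp
  from this[of K] cmod_stieltjes_le[OF A N, of "Complex E (2 ^ K * \<eta>)" v] show ?thesis
    using \<eta> by simp
qed

section \<open>Probability estimates\<close>

text \<open>The event is covered by a superlevel set of the determinant, which is measurable and to
  which Markov's inequality applies.\<close>

lemma stieltjes_exceptional_set:
  fixes \<rho> :: "real \<Rightarrow> real"
  assumes meas: "\<rho> \<in> borel_measurable borel"
    and nonneg: "\<And>x. 0 \<le> \<rho> x" and bounded: "\<And>x. \<rho> x \<le> B"
    and prob: "prob_space (density lborel (\<lambda>x. ennreal (\<rho> x)))"
    and A: "hermitian_mat N A" and N: "0 < N" and \<eta>: "0 < \<eta>"
  obtains X where "X \<in> sets (potential_law N \<rho>)"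
    "measure (potential_law N \<rho>) X \<le> exp (- \<mu> * real N * \<eta>)"
    "\<And>v. v \<in> space (potential_law N \<rho>) \<Longrightarrow>
      (exp 1 - 1) * pi * B + \<mu> < Im (stieltjes N A v (Complex E \<eta>)) \<Longrightarrow> v \<in> X"
proof -
  define c where "c = (exp 1 - 1) * pi * B"
  define t where "t = (exp 1 - 1) * \<eta>"
  define z where "z = Complex E \<eta>"
  have z: "0 < Im z" using \<eta> by (simp add: z_def)
  let ?L = "potential_law N \<rho>"
  interpret L: prob_space ?L
    unfolding potential_law_def by (rule prob_space_PiM) (rule prob)
  define D where "D v = det_re_inv t N (diag_shift (rotated_shift A z) v)" for v
  have B: "0 \<le> B" using nonneg[of 0] bounded[of 0] by linarith
  have t: "0 \<le> t" using \<eta> by (simp add: t_def)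
  have acc: "accretive N (rotated_shift A z)" by (rule accretive_rotated_shift[OF A z])
  have D0: "0 \<le> D v" for v
    unfolding D_def using det_re_inv_pos[OF accretive_diag_shift[OF acc] t] by (rule less_imp_le)
  have [measurable]: "D \<in> borel_measurable ?L"
    unfolding D_def potential_law_def
    by (intro borel_measurable_det_re_inv borel_measurable_diag_shift) auto
  \<comment> \<open>The expectation is at most exp (N \<eta> c), so dividing by this threshold
    leaves exactly exp (-\<mu> N \<eta>).\<close>
  define r where "r = exp (real N * \<eta> * (c + \<mu>))"
  have r: "0 < r" by (simp add: r_def)
  define X where "X = {v \<in> space ?L. r \<le> D v}"
  have X: "X \<in> sets ?L" unfolding X_def by measurable
  have "emeasure ?L X = emeasure ?L {v \<in> space ?L. 1 \<le> ennreal (1 / r) * ennreal (D v)}"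
  proof -
    have "1 \<le> ennreal (1 / r) * ennreal (D v) \<longleftrightarrow> r \<le> D v" for v
    proof -
      have "ennreal (1 / r) * ennreal (D v) = ennreal (D v / r)"
        using r D0 by (simp flip: ennreal_mult)
      then show ?thesis using r D0[of v] by (simp add: ennreal_1[symmetric] del: ennreal_1)
    qed
    then show ?thesis by (simp add: X_def)
  qed
  also have "\<dots> \<le> ennreal (1 / r) * (\<integral>\<^sup>+v. ennreal (D v) * indicator (space ?L) v \<partial>?L)"
    by (rule nn_integral_Markov_inequality) measurable
  also have "(\<integral>\<^sup>+v. ennreal (D v) * indicator (space ?L) v \<partial>?L) = (\<integral>\<^sup>+v. ennreal (D v) \<partial>?L)"
    by (rule nn_integral_cong) simp
  also have "\<dots> \<le> ennreal ((1 + t * pi * B) ^ N)"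
    unfolding D_def by (rule nn_integral_det_re_inv_le[OF meas nonneg bounded prob t acc])
  also have "(1 + t * pi * B) ^ N \<le> exp (real N * \<eta> * c)"
  proof -
    have "(1 + t * pi * B) ^ N \<le> exp (t * pi * B) ^ N"
      using t B by (intro power_mono exp_ge_add_one_self) auto
    also have "\<dots> = exp (real N * \<eta> * c)"
      unfolding exp_of_nat_mult[symmetric] by (simp add: t_def c_def mult_ac)
    finally show ?thesis .
  qed
  finally have "emeasure ?L X \<le> ennreal (1 / r) * ennreal (exp (real N * \<eta> * c))"
    by (simp add: mult_left_mono ennreal_leI)
  also have "\<dots> = ennreal (exp (- \<mu> * real N * \<eta>))"
    using r by (simp add: r_def exp_diff[symmetric] algebra_simps flip: ennreal_mult)
  finally have "measure ?L X \<le> exp (- \<mu> * real N * \<eta>)"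
    by (simp add: L.emeasure_eq_measure)
  moreover have "v \<in> X" if v: "v \<in> space ?L" "c + \<mu> < Im (stieltjes N A v z)" for v
  proof -
    have "r \<le> exp (real N * Im z * Im (stieltjes N A v z))"
      using v(2) z N by (simp add: r_def z_def)
    also have "\<dots> \<le> D v"
      using exp_Im_stieltjes_le[OF A N z, of v] by (simp add: D_def t_def z_def)
    finally show ?thesis using v(1) by (simp add: X_def)
  qed
  ultimately show ?thesis using that[OF X] by (simp add: c_def z_def)
qed

theorem theorem2p2:
  fixes \<rho> :: "real \<Rightarrow> real"
  assumes meas: "\<rho> \<in> borel_measurable borel"
    and nonneg: "\<And>x. \<rho> x \<ge> 0"
    and integrable: "integrable lborel \<rho>"
    and normalized: "(\<integral>x. \<rho> x \<partial>lborel) = 1"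
    and bounded: "\<exists>B. \<forall>x. \<rho> x \<le> B"
  shows "\<exists>c C. 0 < c \<and> 0 < C \<and>
    (\<forall>N::nat. \<forall>A::complex mat. \<forall>\<mu>::real. \<forall>E \<eta>::real.
       0 < N \<longrightarrow> hermitian_mat N A \<longrightarrow> 0 < \<mu> \<longrightarrow> 0 < \<eta> \<longrightarrow>
       measure (potential_law N \<rho>)
         {v \<in> space (potential_law N \<rho>). Im (stieltjes N A v (Complex E \<eta>)) > c + \<mu>}
         \<le> exp (- \<mu> * real N * \<eta>)
     \<and> measure (potential_law N \<rho>)
         {v \<in> space (potential_law N \<rho>).
            cmod (stieltjes N A v (Complex E \<eta>)) > c * (1 + ln (1 + 1 / \<eta>))}
         \<le> C / \<eta>^2 * exp (- real N * \<eta>))"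
proof -
  from bounded obtain B where B: "\<And>x. \<rho> x \<le> B" by blast
  have B0: "0 \<le> B" using nonneg[of 0] B[of 0] by linarith
  have prob: "prob_space (density lborel (\<lambda>x. ennreal (\<rho> x)))"
  proof (rule prob_spaceI)
    have "emeasure (density lborel (\<lambda>x. ennreal (\<rho> x))) (space (density lborel (\<lambda>x. ennreal (\<rho> x)))) =
        (\<integral>\<^sup>+x. ennreal (\<rho> x) \<partial>lborel)"
      using meas by (simp add: emeasure_density)
    also have "\<dots> = 1"
      using nn_integral_eq_integral[OF integrable] nonneg by (simp add: normalized)
    finally show "emeasure (density lborel (\<lambda>x. ennreal (\<rho> x)))
      (space (density lborel (\<lambda>x. ennreal (\<rho> x)))) = 1" .
  qed
  define c1 where "c1 = (exp 1 - 1) * pi * B"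
  have c1: "0 \<le> c1" using B0 by (simp add: c1_def)
  \<comment> \<open>One constant for both estimates: it exceeds \<open>c1\<close>, and it satisfies
    (1 + 2 l) (c1 + 1) + 1 \<le> c (1 + l) for l \<ge> 0.\<close>
  define c where "c = 2 * c1 + 3"
  show ?thesis
  \<comment> \<open>The witness 3 for C comes from the bound 3 / \<eta>^2 on the number of dyadic
    scales.\<close>
  proof (rule exI[of _ c], rule exI[of _ 3], intro conjI allI impI)
    show "0 < c" using c1 by (simp add: c_def)
    show "(0::real) < 3" by simp
  next
    fix N :: nat and A :: "complex mat" and \<mu> E \<eta> :: real
    assume N: "0 < N" and A: "hermitian_mat N A" and \<mu>: "0 < \<mu>" and \<eta>: "0 < \<eta>"
    let ?L = "potential_law N \<rho>"
    interpret L: prob_space ?L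
      unfolding potential_law_def by (rule prob_space_PiM) (rule prob)
    obtain X where X: "X \<in> sets ?L" "measure ?L X \<le> exp (- \<mu> * real N * \<eta>)"
      "\<And>v. v \<in> space ?L \<Longrightarrow> c1 + \<mu> < Im (stieltjes N A v (Complex E \<eta>)) \<Longrightarrow> v \<in> X"
      using stieltjes_exceptional_set[OF meas nonneg B prob A N \<eta>] unfolding c1_def by metis
    have "{v \<in> space ?L. Im (stieltjes N A v (Complex E \<eta>)) > c + \<mu>} \<subseteq> X"
      using X(3) c1 by (force simp: c_def)
    from L.finite_measure_mono[OF this X(1)] X(2)
    show "measure ?L {v \<in> space ?L. Im (stieltjes N A v (Complex E \<eta>)) > c + \<mu>}
      \<le> exp (- \<mu> * real N * \<eta>)" by linarith
  next
    fix N :: nat and A :: "complex mat" and \<mu> E \<eta> :: real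
    assume N: "0 < N" and A: "hermitian_mat N A" and \<mu>: "0 < \<mu>" and \<eta>: "0 < \<eta>"
    let ?L = "potential_law N \<rho>"
    interpret L: prob_space ?L
      unfolding potential_law_def by (rule prob_space_PiM) (rule prob)
    define l where "l = ln (1 + 1 / \<eta>)"
    \<comment> \<open>The least number of doublings that lifts \<eta> to at least 1; truncation by
      \<open>nat\<close> makes it 0 when \<eta> \<ge> 1.\<close>
    define K where "K = nat \<lceil>log 2 (1 / \<eta>)\<rceil>"
    have l0: "0 \<le> l" using \<eta> by (simp add: l_def)
    have K1: "1 \<le> 2 ^ K * \<eta>"
    proof -
      have "log 2 (1 / \<eta>) \<le> real K" unfolding K_def by linarith
      then have "1 / \<eta> \<le> 2 powr real K" using \<eta> by (subst (asm) log_le_iff) auto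
      then show ?thesis using \<eta> by (simp add: powr_realpow field_simps)
    qed
    have Kl: "real K \<le> 1 + 2 * l"
    proof (cases "\<eta> < 1")
      case True
      have "log 2 (1 / \<eta>) \<le> 2 * ln (1 / \<eta>)"
      proof -
        \<comment> \<open>The change of base costs 1 / ln 2 \<le> 2; the summand 1 in
          \<open>Kl\<close> pays for the ceiling.\<close>
        have "ln (1 / \<eta>) \<le> 2 * ln (1 / \<eta>) * ln 2"
          using ln2_ge_two_thirds True \<eta> mult_left_mono[of "1/2" "ln 2" "2 * ln (1 / \<eta>)"] by simp
        then show ?thesis by (simp add: log_def field_simps)
      qed
      also have "ln (1 / \<eta>) \<le> l" unfolding l_def using \<eta> by (subst ln_le_cancel_iff) (auto simp: add_pos_pos)
      finally have "log 2 (1 / \<eta>) \<le> 2 * l" by simp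
      moreover have "real K \<le> log 2 (1 / \<eta>) + 1"
      proof -
        have "0 \<le> log 2 (1 / \<eta>)" using True \<eta> by simp
        then show ?thesis unfolding K_def by linarith
      qed
      ultimately show ?thesis by linarith
    next
      case False
      then have "log 2 (1 / \<eta>) \<le> 0" using \<eta> by simp
      then have "K = 0" by (simp add: K_def)
      then show ?thesis using l0 by simp
    qed
    have K\<eta>: "real K \<le> 3 / \<eta>^2"
    proof (cases "\<eta> < 1")
      case True
      \<comment> \<open>For \<eta> < 1 this gives 1 + 2 l \<le> 1 + 2 / \<eta> \<le> 3 /
        \<eta>^2.\<close>
      have "l \<le> 1 / \<eta>" unfolding l_def using \<eta> by (intro ln_add_one_self_le_self) auto
      moreover have "1 / \<eta> \<le> 1 / \<eta>^2" "1 \<le> 1 / \<eta>^2"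
        using True \<eta> by (auto simp: power2_eq_square divide_simps mult_le_one)
      ultimately show ?thesis using Kl by simp
    next
      case False
      then have "log 2 (1 / \<eta>) \<le> 0" using \<eta> by simp
      then have "K = 0" by (simp add: K_def)
      then show ?thesis by simp
    qed
    \<comment> \<open>One exceptional set for each height 2^k \<eta>, with \<mu> = 1.\<close>
    have "\<exists>X. X \<in> sets ?L \<and> measure ?L X \<le> exp (- 1 * real N * (2 ^ k * \<eta>)) \<and>
      (\<forall>v\<in>space ?L. c1 + 1 < Im (stieltjes N A v (Complex E (2 ^ k * \<eta>))) \<longrightarrow> v \<in> X)" for k :: nat
    proof -
      have "0 < 2 ^ k * \<eta>" using \<eta> by simp
      from stieltjes_exceptional_set[OF meas nonneg B prob A N this, of 1 E] show ?thesis
        unfolding c1_def by metis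
    qed
    then obtain X where X: "\<And>k. X k \<in> sets ?L"
      "\<And>k. measure ?L (X k) \<le> exp (- 1 * real N * (2 ^ k * \<eta>))"
      "\<And>k v. v \<in> space ?L \<Longrightarrow> c1 + 1 < Im (stieltjes N A v (Complex E (2 ^ k * \<eta>))) \<Longrightarrow> v \<in> X k"
      by metis
    \<comment> \<open>Off the union all \<open>K\<close> imaginary parts are at most c1 + 1, so the
      dyadic bound yields |S| \<le> K (c1 + 1) + 1.\<close>
    have "{v \<in> space ?L. cmod (stieltjes N A v (Complex E \<eta>)) > c * (1 + l)} \<subseteq> (\<Union>k<K. X k)"
    proof (rule subsetI, rule ccontr)
      fix v assume v: "v \<in> {v \<in> space ?L. cmod (stieltjes N A v (Complex E \<eta>)) > c * (1 + l)}"
        and "v \<notin> (\<Union>k<K. X k)"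
      then have "Im (stieltjes N A v (Complex E (2 ^ k * \<eta>))) \<le> c1 + 1" if "k < K" for k
        using X(3)[of v k] that by force
      from cmod_stieltjes_dyadic[OF A N \<eta> this]
      have "cmod (stieltjes N A v (Complex E \<eta>)) \<le> real K * (c1 + 1) + 1 / (2 ^ K * \<eta>)" .
      also have "1 / (2 ^ K * \<eta>) \<le> 1" using K1 by simp
      also have "real K * (c1 + 1) \<le> (1 + 2 * l) * (c1 + 1)"
        using Kl c1 by (intro mult_right_mono) auto
      also have "(1 + 2 * l) * (c1 + 1) + 1 \<le> c * (1 + l)"
        using c1 l0 by (simp add: c_def algebra_simps)
      finally show False using v by simp
    qed
    then have "measure ?L {v \<in> space ?L. cmod (stieltjes N A v (Complex E \<eta>)) > c * (1 + l)}
        \<le> measure ?L (\<Union>k<K. X k)"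
      using X(1) by (intro L.finite_measure_mono) auto
    also have "\<dots> \<le> (\<Sum>k<K. measure ?L (X k))"
      using X(1) by (intro L.finite_measure_subadditive_finite) auto
    also have "\<dots> \<le> (\<Sum>k<K. exp (- real N * \<eta>))"
    proof (rule sum_mono)
      fix k
      \<comment> \<open>Greater heights have smaller exceptional probabilities, so the value at
        height \<eta> bounds every term.\<close>
      have "1 * \<eta> \<le> 2 ^ k * \<eta>" using \<eta> by (intro mult_right_mono) auto
      then have "exp (- 1 * real N * (2 ^ k * \<eta>)) \<le> exp (- real N * \<eta>)" by (simp add: mult_left_mono)
      with X(2)[of k] show "measure ?L (X k) \<le> exp (- real N * \<eta>)" by linarith
    qed
    also have "\<dots> \<le> 3 / \<eta>^2 * exp (- real N * \<eta>)"
      using mult_right_mono[OF K\<eta>, of "exp (- real N * \<eta>)"] by simp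
    finally show "measure ?L {v \<in> space ?L. cmod (stieltjes N A v (Complex E \<eta>)) > c * (1 + ln (1 + 1 / \<eta>))}
      \<le> 3 / \<eta>^2 * exp (- real N * \<eta>)" unfolding l_def .
  qed
qed

end
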